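(* Let $n\ge1$. There exists an isomorphism of projective varieties $\psi_n:R_n\to \mathrm{BS}_n$ such that $$\rho_n\circ\psi_n=\zeta\circ p_n,$$ i.e. the square formed by $\psi_n:R_n\to\mathrm{BS}_n$, $p_n:R_n\to\mathcal{F}l^a_{n+1}$, $\rho_n:\mathrm{BS}_n\to X_{\sigma_n}$ and $\zeta:\mathcal{F}l^a_{n+1}\to X_{\sigma_n}$ commutes.
   Context: All varieties are over $\mathbb{C}$. $V\simeq\mathbb{C}^{n+1}$ has ordered basis $f_1,\dots,f_{n+1}$; $\mathrm{pr}_k(\sum_i a_if_i)=\sum_{i\ne k}a_if_i$. $W\simeq\mathbb{C}^{2n}$ has ordered basis $e_1,\dots,e_{2n}$; $F_i=\langle e_1,\dots,e_i\rangle$ for $0\le i\le 2n$, and $F_\bullet$ is the standard complete flag. Degenerate flag variety, Schubert variety and $\zeta$. $\mathcal{F}l^a_{n+1}=\{(V_1,\dots,V_n)\in\prod_{i=1}^n\mathrm{Gr}_i(V)\mid \mathrm{pr}_i(V_i)\subset V_{i+1},\ 1\le i\le n-1\}$. Let $\sigma_n\in\mathrm{Sym}_{2n}$ be given by $\sigma_n(2k)=k$ ($1\le k\le n$) and $\sigma_n(2k+1)=n+1+k$ ($0\le k\le n-1$). Let $B\subset SL_{2n}$ be the upper triangular matrices and $P\supseteq B$ the parabolic subgroup such that $SL_{2n}/P$ is the variety of flags $W_1\subset\cdots\subset W_n$ in $W$ with $\dim W_i=2i-1$. $X_{\sigma_n}=\overline{B\sigma_nP/P}$ is the closure of the $B$-orbit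 of the flag with $i$-th subspace $\langle e_{\sigma_n(1)},\dots,e_{\sigma_n(2i-1)}\rangle$. For $1\le i\le n$ let $\pi_i:F_{n+i}\to V$ be the linear surjection with $\pi_i(e_k)=0$ for $1\le k\le i-1$, $\pi_i(e_k)=f_k$ for $i\le k\le n+1$, and $\pi_i(e_k)=f_{k-n-1}$ for $n+2\le k\le n+i$. The isomorphism $\zeta:\mathcal{F}l^a_{n+1}\to X_{\sigma_n}$ is $\zeta(V_1,\dots,V_n)=(\pi_1^{-1}(V_1),\dots,\pi_n^{-1}(V_n))$. Indexing. Put $N=\binom{n+1}{2}$. The pairs $\alpha_{i,j}$, $1\le i\le j\le n$, are enumerated as $\beta_1,\dots,\beta_N$ by: $\beta_1=\alpha_{1,n}$, and if $\beta_k=\alpha_{i_k,j_k}$ then $\beta_{k+1}=\alpha_{i_k+1,j_k+1}$ if $j_k<n$ and $\beta_{k+1}=\alpha_{1,n-i_k}$ if $j_k=n$. Put $\ell_k=i_k+j_k-1$. The Feigin–Finkelberg variety $R_n$. For $1\le i\le j\le n$ let $V_{i,j}=\langle f_1,\dots,f_{i-1},f_j,\dots,f_{n+1}\rangle\subseteq V$. $R_n$ is the variety of collections $(Z_{i,j})_{1\le i\le j\le n}$ such that $Z_{i,j}\in\mathrm{Gr}_i(V_{i,j})$, $Z_{i-1,j}\subset Z_{i,j}$ and $\mathrm{pr}_j(Z_{i,j})\subset Z_{i,j+1}$ for all $1\le i\le j\le n$, with the conventions $Z_{0,k}=\{0\}$ and $Z_{k,n+1}=V$ for $1\le k\le n$.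 The map $p_n:R_n\to\mathcal{F}l^a_{n+1}$ (a desingularization) is $(Z_{i,j})\mapsto(Z_{1,1},Z_{2,2},\dots,Z_{n,n})$. The Bott–Samelson variety $\mathrm{BS}_n$. It is the variety of sequences $(U^{\beta_k}_\bullet)_{k=0}^N$ of complete flags $U^{\beta_k}_1\subset\cdots\subset U^{\beta_k}_{2n-1}\subset W$ such that $U^{\beta_0}_\bullet=F_\bullet$ and, for each $0\le k<N$, $U^{\beta_{k+1}}_i=U^{\beta_k}_i$ for all $i\neq\ell_{k+1}$. (It is the Bott–Samelson variety of the reduced expression $\sigma_n=s_{\ell_1}s_{\ell_2}\cdots s_{\ell_N}$, $s_i=(i,i+1)$.) The map $\rho_n:\mathrm{BS}_n\to X_{\sigma_n}$ (a desingularization) is $(U^{\beta_k}_\bullet)_{k=0}^N\mapsto(U^{\beta_N}_{1},U^{\beta_N}_3,\dots,U^{\beta_N}_{2n-1})$. *)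

theory Defs
  imports
    "HOL-Analysis.Function_Topology"
    "HOL-Library.Function_Algebras"
    "Jordan_Normal_Form.Determinant"
begin

section \<open>Coordinate spaces\<close>

text \<open>Vectors are functions \<^typ>\<open>nat \<Rightarrow> complex\<close>; the space \<open>\<complex>\<^sup>m\<close> consists of those supported on
  \<open>{1..m}\<close>. Indices start at 1. The basis vector \<open>unit k\<close> plays the role of \<open>f\<^sub>k\<close> in
  \<open>V = coord_space (n + 1)\<close> and of \<open>e\<^sub>k\<close> in \<open>W = coord_space (2 * n)\<close>.\<close>

type_synonym cvec = "nat \<Rightarrow> complex"

definition cscale :: "complex \<Rightarrow> cvec \<Rightarrow> cvec" where
  "cscale c v = (\<lambda>i. c * v i)"

global_interpretation cvs: vector_space cscale
  by unfold_locales (auto simp: cscale_def fun_eq_iff algebra_simps)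

definition unit :: "nat \<Rightarrow> cvec" where
  "unit k = (\<lambda>j. if j = k then 1 else 0)"

definition coord_space :: "nat \<Rightarrow> cvec set" where
  "coord_space m = {v. \<forall>i. i \<notin> {1..m} \<longrightarrow> v i = 0}"

definition Gr :: "nat \<Rightarrow> cvec set \<Rightarrow> cvec set set" where
  "Gr d E = {S. cvs.subspace S \<and> S \<subseteq> E \<and> cvs.dim S = d}"

section \<open>Subvarieties of products of Grassmannians\<close>

text \<open>A record \<open>X\<close> describes a set of points of the product over \<open>i \<in> factors X\<close> of the
  Grassmannians of \<open>rank X i\<close>-dimensional subspaces of \<open>\<complex>\<^sup>m\<close>, \<open>m = ambient X\<close>. It carries the
  reduced structure induced by the Pluecker embeddings of the factors, i.e. that of a subset of a
  product of projective spaces with multihomogeneous coordinates. Families of subspaces are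
  extensional (they lie in a \<open>\<Pi>\<^sub>E\<close>), so that equal points are equal functions.\<close>

record 'i grvar =
  factors :: "'i set"
  rank :: "'i \<Rightarrow> nat"
  ambient :: nat
  points :: "('i \<Rightarrow> cvec set) set"

definition frame :: "cvec set \<Rightarrow> cvec list \<Rightarrow> bool" where
  "frame S b \<longleftrightarrow> distinct b \<and> cvs.independent (set b) \<and> cvs.span (set b) = S"

text \<open>Pluecker coordinates are indexed by all tuples of row indices, not only by the strictly
  increasing ones. The additional coordinates are zero or agree with an increasing one up to sign,
  hence they do not change which functions are polynomial.\<close>

definition plucker :: "cvec list \<Rightarrow> nat list \<Rightarrow> complex" where
  "plucker b r = Determinant.det (mat (length b) (length b) (\<lambda>(s, t). (b ! t) (r ! s)))"

definition plucker_vars :: "'i grvar \<Rightarrow> ('i \<times> nat list) set" where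
  "plucker_vars X = {(i, r). i \<in> factors X \<and> length r = rank X i \<and> set r \<subseteq> {1..ambient X}}"

text \<open>The multihomogeneous coordinate vectors of a point, one for each choice of bases.\<close>

definition plucker_coords :: "'i grvar \<Rightarrow> ('i \<Rightarrow> cvec set) \<Rightarrow> ('i \<times> nat list \<Rightarrow> complex) set" where
  "plucker_coords X x =
     {(\<lambda>(i, r). plucker (b i) r) | b. \<forall>i\<in>factors X. frame (x i) (b i)}"

text \<open>\<open>multihom A D P\<close>: \<open>P\<close> is a polynomial function in the variables \<open>A\<close> that is homogeneous of
  degree \<open>D i\<close> in the variables \<open>(i, _)\<close>, for each \<open>i\<close>.\<close>

inductive multihom ::
  "('i \<times> 'c) set \<Rightarrow> ('i \<Rightarrow> nat) \<Rightarrow> (('i \<times> 'c \<Rightarrow> complex) \<Rightarrow> complex) \<Rightarrow> bool"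
  for A :: "('i \<times> 'c) set"
where
  const: "multihom A (\<lambda>_. 0) (\<lambda>p. c)"
| var: "(i, r) \<in> A \<Longrightarrow> multihom A ((\<lambda>_. 0)(i := 1)) (\<lambda>p. p (i, r))"
| add: "multihom A D P \<Longrightarrow> multihom A D Q \<Longrightarrow> multihom A D (\<lambda>p. P p + Q p)"
| mult: "multihom A D P \<Longrightarrow> multihom A E Q \<Longrightarrow> multihom A (\<lambda>i. D i + E i) (\<lambda>p. P p * Q p)"

text \<open>The Zariski topology, generated by the principal open sets. Whether a multihomogeneous
  polynomial vanishes does not depend on the coordinate vector chosen.\<close>

definition principal_open :: "'i grvar \<Rightarrow> (('i \<times> nat list \<Rightarrow> complex) \<Rightarrow> complex) \<Rightarrow> ('i \<Rightarrow> cvec set) set" where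
  "principal_open X P = {x \<in> points X. \<forall>p\<in>plucker_coords X x. P p \<noteq> 0}"

definition zariski :: "'i grvar \<Rightarrow> ('i \<Rightarrow> cvec set) topology" where
  "zariski X = topology_generated_by
     {principal_open X P | P. \<exists>D. multihom (plucker_vars X) D P}"

definition regular_on :: "'i grvar \<Rightarrow> ('i \<Rightarrow> cvec set) set \<Rightarrow> (('i \<Rightarrow> cvec set) \<Rightarrow> complex) \<Rightarrow> bool" where
  "regular_on X U f \<longleftrightarrow> openin (zariski X) U \<and>
     (\<forall>x\<in>U. \<exists>O' D P Q. openin (zariski X) O' \<and> x \<in> O' \<and> O' \<subseteq> U \<and>
        multihom (plucker_vars X) D P \<and> multihom (plucker_vars X) D Q \<and>
        (\<forall>y\<in>O'. \<forall>p\<in>plucker_coords X y. Q p \<noteq> 0 \<and> f y = P p / Q p))"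

definition morphism ::
  "'i grvar \<Rightarrow> 'j grvar \<Rightarrow> (('i \<Rightarrow> cvec set) \<Rightarrow> 'j \<Rightarrow> cvec set) \<Rightarrow> bool" where
  "morphism X Y \<phi> \<longleftrightarrow> continuous_map (zariski X) (zariski Y) \<phi> \<and>
     (\<forall>U f. regular_on Y U f \<longrightarrow> regular_on X {x \<in> points X. \<phi> x \<in> U} (f \<circ> \<phi>))"

definition isomorphism ::
  "'i grvar \<Rightarrow> 'j grvar \<Rightarrow> (('i \<Rightarrow> cvec set) \<Rightarrow> 'j \<Rightarrow> cvec set) \<Rightarrow> bool" where
  "isomorphism X Y \<phi> \<longleftrightarrow> morphism X Y \<phi> \<and>
     (\<exists>\<chi>. morphism Y X \<chi> \<and> (\<forall>x\<in>points X. \<chi> (\<phi> x) = x) \<and> (\<forall>y\<in>points Y. \<phi> (\<chi> y) = y))"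

lemma topspace_zariski [simp]: "topspace (zariski X) = points X"
proof -
  have "principal_open X (\<lambda>_. 1) = points X"
    by (auto simp: principal_open_def)
  moreover have "multihom (plucker_vars X) (\<lambda>_. 0) (\<lambda>_. 1)"
    by (rule multihom.const)
  ultimately have "points X \<in> {principal_open X P | P. \<exists>D. multihom (plucker_vars X) D P}"
    by blast
  then show ?thesis
    by (auto simp: zariski_def topology_generated_by_topspace principal_open_def)
qed

section \<open>The degenerate flag variety and the Schubert variety\<close>

definition pr :: "nat \<Rightarrow> cvec \<Rightarrow> cvec" where
  "pr k v = v(k := 0)"

definition Fla :: "nat \<Rightarrow> nat grvar" where
  "Fla n = \<lparr>factors = {1..n}, rank = (\<lambda>i. i), ambient = n + 1,
     points = {V \<in> \<Pi>\<^sub>E i\<in>{1..n}. Gr i (coord_space (n + 1)).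
                \<forall>i. 1 \<le> i \<and> i < n \<longrightarrow> pr i ` V i \<subseteq> V (i + 1)}\<rparr>"

definition sigma :: "nat \<Rightarrow> nat \<Rightarrow> nat" where
  "sigma n k = (if even k then k div 2 else n + 1 + k div 2)"

text \<open>The flags \<open>W\<^sub>1 \<subset> \<dots> \<subset> W\<^sub>n\<close> in \<open>W\<close> with \<open>dim W\<^sub>i = 2 * i - 1\<close>, i.e. \<open>SL\<^sub>2\<^sub>n / P\<close>.\<close>

definition odd_flags :: "nat \<Rightarrow> nat grvar" where
  "odd_flags n = \<lparr>factors = {1..n}, rank = (\<lambda>i. 2 * i - 1), ambient = 2 * n,
     points = {S \<in> \<Pi>\<^sub>E i\<in>{1..n}. Gr (2 * i - 1) (coord_space (2 * n)).
                \<forall>i. 1 \<le> i \<and> i < n \<longrightarrow> S i \<subseteq> S (i + 1)}\<rparr>"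

text \<open>Square matrices of size \<open>m\<close> are indexed from 1 here, like vectors.\<close>

definition borel_SL :: "nat \<Rightarrow> (nat \<Rightarrow> nat \<Rightarrow> complex) set" where
  "borel_SL m = {g. (\<forall>i j. j < i \<longrightarrow> g i j = 0) \<and>
     Determinant.det (mat m m (\<lambda>(i, j). g (i + 1) (j + 1))) = 1}"

definition mat_act :: "nat \<Rightarrow> (nat \<Rightarrow> nat \<Rightarrow> complex) \<Rightarrow> cvec \<Rightarrow> cvec" where
  "mat_act m g v = (\<lambda>i. if i \<in> {1..m} then \<Sum>j=1..m. g i j * v j else 0)"

definition sigma_orbit :: "nat \<Rightarrow> (nat \<Rightarrow> cvec set) set" where
  "sigma_orbit n = {(\<lambda>i\<in>{1..n}. mat_act (2 * n) g ` cvs.span ((unit \<circ> sigma n) ` {1..2 * i - 1}))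
     | g. g \<in> borel_SL (2 * n)}"

definition X_sigma :: "nat \<Rightarrow> nat grvar" where
  "X_sigma n = (odd_flags n)\<lparr>points := zariski (odd_flags n) closure_of sigma_orbit n\<rparr>"

text \<open>The subspaces \<open>F\<^sub>i\<close> are the \<open>coord_space i\<close>.\<close>

definition pi_map :: "nat \<Rightarrow> nat \<Rightarrow> cvec \<Rightarrow> cvec" where
  "pi_map n i w = (\<Sum>k=i..n + 1. cscale (w k) (unit k))
     + (\<Sum>k=n + 2..n + i. cscale (w k) (unit (k - n - 1)))"

text \<open>The maps \<open>zeta n\<close>, \<open>p_map n\<close> and \<open>rho n\<close> are restricted to their domains. The codomain of
  \<open>zeta n\<close> and \<open>rho n\<close> is \<open>points (X_sigma n)\<close>, that of \<open>p_map n\<close> is \<open>points (Fla n)\<close>;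
  functions do not record a codomain, so \<open>X_sigma\<close> occurs in no later definition.\<close>

definition zeta :: "nat \<Rightarrow> (nat \<Rightarrow> cvec set) \<Rightarrow> nat \<Rightarrow> cvec set" where
  "zeta n = (\<lambda>V\<in>points (Fla n). \<lambda>i\<in>{1..n}. {w \<in> coord_space (n + i). pi_map n i w \<in> V i})"

section \<open>The Feigin--Finkelberg variety\<close>

definition Vsub :: "nat \<Rightarrow> nat \<Rightarrow> nat \<Rightarrow> cvec set" where
  "Vsub n i j = cvs.span (unit ` ({1..<i} \<union> {j..n + 1}))"

text \<open>The conventions \<open>Z\<^bsub>0,k\<^esub> = {0}\<close> and \<open>Z\<^bsub>k,n+1\<^esub> = V\<close>.\<close>

definition Zext :: "nat \<Rightarrow> (nat \<times> nat \<Rightarrow> cvec set) \<Rightarrow> nat \<Rightarrow> nat \<Rightarrow> cvec set" where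
  "Zext n Z i j = (if i = 0 then {0} else if j = n + 1 then coord_space (n + 1) else Z (i, j))"

definition R_indices :: "nat \<Rightarrow> (nat \<times> nat) set" where
  "R_indices n = {(i, j). 1 \<le> i \<and> i \<le> j \<and> j \<le> n}"

definition R :: "nat \<Rightarrow> (nat \<times> nat) grvar" where
  "R n = \<lparr>factors = R_indices n, rank = fst, ambient = n + 1,
     points = {Z \<in> \<Pi>\<^sub>E (i, j)\<in>R_indices n. Gr i (Vsub n i j).
                \<forall>(i, j)\<in>R_indices n. Zext n Z (i - 1) j \<subseteq> Zext n Z i j \<and>
                  pr j ` Zext n Z i j \<subseteq> Zext n Z i (j + 1)}\<rparr>"

definition p_map :: "nat \<Rightarrow> (nat \<times> nat \<Rightarrow> cvec set) \<Rightarrow> nat \<Rightarrow> cvec set" where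
  "p_map n = (\<lambda>Z\<in>points (R n). \<lambda>i\<in>{1..n}. Z (i, i))"

section \<open>The Bott--Samelson variety\<close>

definition beta_step :: "nat \<Rightarrow> nat \<times> nat \<Rightarrow> nat \<times> nat" where
  "beta_step n = (\<lambda>(i, j). if j < n then (i + 1, j + 1) else (1, n - i))"

text \<open>\<open>beta n k\<close> is the pair \<open>(i\<^sub>k, j\<^sub>k)\<close>; it is meaningful for \<open>1 \<le> k \<le> N\<close>.\<close>

definition beta :: "nat \<Rightarrow> nat \<Rightarrow> nat \<times> nat" where
  "beta n k = (beta_step n ^^ (k - 1)) (1, n)"

definition ell :: "nat \<Rightarrow> nat \<Rightarrow> nat" where
  "ell n k = fst (beta n k) + snd (beta n k) - 1"

definition N_of :: "nat \<Rightarrow> nat" where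
  "N_of n = (n + 1) choose 2"

text \<open>\<open>U (k, m)\<close> is the \<open>m\<close>-dimensional member of the \<open>k\<close>-th flag.\<close>

definition BS :: "nat \<Rightarrow> (nat \<times> nat) grvar" where
  "BS n = \<lparr>factors = {0..N_of n} \<times> {1..2 * n - 1}, rank = snd, ambient = 2 * n,
     points = {U \<in> \<Pi>\<^sub>E (k, m)\<in>{0..N_of n} \<times> {1..2 * n - 1}. Gr m (coord_space (2 * n)).
                (\<forall>k\<le>N_of n. \<forall>m. 1 \<le> m \<and> m < 2 * n - 1 \<longrightarrow> U (k, m) \<subseteq> U (k, m + 1)) \<and>
                (\<forall>m\<in>{1..2 * n - 1}. U (0, m) = coord_space m) \<and>
                (\<forall>k<N_of n. \<forall>m\<in>{1..2 * n - 1}. m \<noteq> ell n (k + 1) \<longrightarrow> U (k + 1, m) = U (k, m))}\<rparr>"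

definition rho :: "nat \<Rightarrow> (nat \<times> nat \<Rightarrow> cvec set) \<Rightarrow> nat \<Rightarrow> cvec set" where
  "rho n = (\<lambda>U\<in>points (BS n). \<lambda>i\<in>{1..n}. U (N_of n, 2 * i - 1))"

end

theory Submission
  imports Defs
begin

text \<open>The flags of a point of \<open>BS n\<close> are governed by lattice paths. At time \<open>k\<close>, each position \<open>m\<close> is
  occupied by a pair \<open>(i, j)\<close> with \<open>i + j = m + 1\<close> and \<open>0 \<le> i \<le> j \<le> n + 1\<close>, and the pairs at consecutive
  positions differ by a unit step in \<open>i\<close> or in \<open>j\<close> (\<open>cell_adjacent\<close>). At the start the path runs
  through the boundary pairs, those with \<open>i = 0\<close> or \<open>j = n + 1\<close>; the step \<open>\<beta>\<^sub>k = (i, j)\<close> flips the corner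
  \<open>(i - 1, j + 1)\<close> to \<open>(i, j)\<close>. A position changes its subspace only when it changes its pair, so a point
  of \<open>BS n\<close> amounts to a family of subspaces \<open>U\<^bsub>i,j\<^esub>\<close> of dimension \<open>i + j - 1\<close>, equal to
  \<open>F\<^bsub>i+j-1\<^esub>\<close> on the boundary, with \<open>U\<^bsub>i-1,j\<^esub> \<subseteq> U\<^bsub>i,j\<^esub> \<subseteq> U\<^bsub>i,j+1\<^esub>\<close> (\<open>BS_at_cell\<close>, \<open>at_cell_mono\<close>).

  Following these inclusions to the boundary shows \<open>F\<^bsub>j-1\<^esub> \<subseteq> U\<^bsub>i,j\<^esub> \<subseteq> F\<^bsub>n+i\<^esub>\<close>. There is a linear surjection
  \<open>F\<^bsub>n+i\<^esub> \<rightarrow> V\<^bsub>i,j\<^esub>\<close> with kernel \<open>F\<^bsub>j-1\<^esub>\<close>, equal to \<open>\<pi>\<^sub>i\<close> for \<open>i = j\<close>, so that the \<open>U\<^bsub>i,j\<^esub>\<close> are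
  the preimages of unique subspaces \<open>Z\<^bsub>i,j\<^esub> \<subseteq> V\<^bsub>i,j\<^esub>\<close> of dimension \<open>i\<close>. The surjection for \<open>(i, j)\<close> restricts to
  the one for \<open>(i - 1, j)\<close>, and the surjection for \<open>(i, j + 1)\<close> is the one for \<open>(i, j)\<close> followed by
  \<open>pr j\<close>. Therefore the inclusions between the \<open>U\<^bsub>i,j\<^esub>\<close> are precisely the conditions that define \<open>R n\<close>, and
  taking preimages is a bijection (\<open>psi_in_BS\<close>, \<open>chi_in_R\<close>, \<open>chi_psi\<close>, \<open>psi_chi\<close>). The last path passes through
  \<open>(i, i)\<close> at position \<open>2 * i - 1\<close>, which makes the square commute (\<open>rho_psi\<close>).

  For regularity, a basis of a preimage is \<open>e\<^sub>1, \<dots>, e\<^bsub>j-1\<^esub>\<close> followed by lifts of a basis of \<open>Z\<^bsub>i,j\<^esub>\<close>. Laplace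
  expansion along the unit columns expresses the Pluecker coordinates of \<open>U\<^bsub>i,j\<^esub>\<close> as linear forms in those of
  \<open>Z\<^bsub>i,j\<^esub>\<close>; conversely every nonzero coordinate of \<open>Z\<^bsub>i,j\<^esub>\<close> is a coordinate of \<open>U\<^bsub>i,j\<^esub>\<close>. Maps that
  are given by forms in this way are morphisms (\<open>morphismI\<close>).\<close>

section \<open>Multihomogeneous polynomials\<close>

text \<open>Homogeneity in each group of variables separately. With all factors equal to 1 this says that
  \<open>P\<close> depends on its argument only through the variables in \<open>A\<close>.\<close>

lemma multihom_rescale:
  assumes "multihom A D P" "finite F" "fst ` A \<subseteq> F"
    and "\<And>i r. (i, r) \<in> A \<Longrightarrow> q (i, r) = c i * p (i, r)"
  shows "P q = (\<Prod>i\<in>F. c i ^ D i) * P p"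
  using assms(1)
proof induction
  case (var i r)
  have "(\<Prod>k\<in>F. c k ^ ((\<lambda>_. 0)(i := 1)) k) = (\<Prod>k\<in>F. if k = i then c k else 1)"
    by (rule prod.cong) auto
  then show ?case
    using assms(2-4) var by (force simp: prod.delta)
next
  case (mult D P E Q)
  then show ?case
    by (simp add: power_add prod.distrib)
qed (simp_all add: algebra_simps)

text \<open>Substituting forms of multidegree \<open>E j\<close> for the variables of group \<open>j\<close>.
  The new multidegree depends on \<open>D\<close> but not on \<open>P\<close>, so numerator and denominator of
  a regular function keep equal degrees.\<close>

lemma multihom_compose:
  assumes "multihom B D P" "finite F" "fst ` B \<subseteq> F"
    and "\<And>j r. (j, r) \<in> B \<Longrightarrow> multihom A (E j) (L (j, r))"
  shows "multihom A (\<lambda>i. \<Sum>j\<in>F. D j * E j i) (\<lambda>p. P (\<lambda>v. L v p))"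
  using assms(1)
proof induction
  case (const c)
  then show ?case by (simp add: multihom.const)
next
  case (var j r)
  have "(\<Sum>k\<in>F. ((\<lambda>_. 0)(j := 1)) k * E k i) = (\<Sum>k\<in>F. if k = j then E k i else 0)" for i
    by (rule sum.cong) auto
  moreover have "j \<in> F"
    using assms(3) var by force
  ultimately show ?case
    using assms(2,4) var by (simp add: sum.delta)
next
  case (add D P Q)
  show ?case
    using add.IH by (rule multihom.add)
next
  case (mult D P E' Q)
  then show ?case
    using multihom.mult[OF mult.IH] by (simp add: distrib_right sum.distrib)
qed

lemma multihom_cmult:
  assumes "multihom A D P"
  shows "multihom A D (\<lambda>p. c * P p)"
  using multihom.mult[OF multihom.const assms] by simp

text \<open>The zero polynomial is homogeneous of every degree, but the generating rules provide it in degree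
  0 only; in degree 1 it is obtained as 0 times a variable, which must therefore exist.\<close>

lemma multihom_zero:
  assumes "(i, r) \<in> A"
  shows "multihom A ((\<lambda>_. 0)(i := 1)) (\<lambda>p. 0)"
  using multihom_cmult[OF multihom.var[OF assms], of 0] by (simp only: mult_zero_left)

text \<open>Terms with coefficient 0 are allowed to refer to indices that are not variables; this is
  convenient for linear forms given by a formula that is meaningful on part of the index set only.\<close>

lemma multihom_linear:
  assumes "finite T" "(i, r\<^sub>0) \<in> A" "\<And>t. t \<in> T \<Longrightarrow> w t \<noteq> 0 \<Longrightarrow> (i, g t) \<in> A"
  shows "multihom A ((\<lambda>_. 0)(i := 1)) (\<lambda>p. \<Sum>t\<in>T. w t * p (i, g t))"
  using assms(1,3)
proof (induction T)
  case empty
  show ?case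
    using multihom_zero[OF assms(2)] by (simp only: sum.empty)
next
  case (insert t T)
  have "multihom A ((\<lambda>_. 0)(i := 1)) (\<lambda>p. w t * p (i, g t))"
  proof (cases "w t = 0")
    case True
    then show ?thesis
      using multihom_zero[OF assms(2)] by (simp only: mult_zero_left)
  next
    case False
    then show ?thesis
      using insert.prems by (intro multihom_cmult multihom.var) simp
  qed
  moreover have "multihom A ((\<lambda>_. 0)(i := 1)) (\<lambda>p. \<Sum>t\<in>T. w t * p (i, g t))"
    using insert by blast
  ultimately have "multihom A ((\<lambda>_. 0)(i := 1)) (\<lambda>p. w t * p (i, g t) + (\<Sum>t\<in>T. w t * p (i, g t)))"
    by (rule multihom.add)
  then show ?case
    by (simp only: sum.insert[OF insert.hyps])
qed

section \<open>Frames and Pluecker coordinates\<close>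

lemma sum_cvec_apply: "(\<Sum>v\<in>T. f v) x = (\<Sum>v\<in>T. f v x)" for f :: "'a \<Rightarrow> cvec"
  by (induction T rule: infinite_finite_induct) auto

lemma span_list_coefficients:
  assumes "distinct b" "v \<in> cvs.span (set b)"
  obtains u where "\<And>x. v x = (\<Sum>s<length b. (b ! s) x * u s)"
proof -
  obtain u where "v = (\<Sum>w\<in>set b. cscale (u w) w)"
    using assms(2) by (auto simp: cvs.span_finite)
  then have "v x = (\<Sum>w\<in>set b. w x * u w)" for x
    by (simp add: sum_cvec_apply cscale_def mult.commute)
  also have "\<dots> x = (\<Sum>s<length b. (b ! s) x * u (b ! s))" for x
    using sum.reindex_bij_betw[OF bij_betw_nth[OF assms(1) refl refl], of "\<lambda>w. w x * u w"] by simp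
  finally have "v x = (\<Sum>s<length b. (b ! s) x * u (b ! s))" for x .
  then show ?thesis
    by (rule that)
qed

lemma independent_list_coefficients:
  assumes "distinct b" "cvs.independent (set b)"
    and "\<And>x. (\<Sum>s<length b. (b ! s) x * u s) = 0" "t < length b"
  shows "u t = 0"
proof -
  let ?i = "\<lambda>w. the_inv_into {..<length b} ((!) b) w"
  have inj: "inj_on ((!) b) {..<length b}"
    using assms(1) by (simp add: inj_on_nth)
  have "(\<Sum>w\<in>set b. w x * u (?i w)) = (\<Sum>s<length b. (b ! s) x * u (?i (b ! s)))" for x
    using sum.reindex_bij_betw[OF bij_betw_nth[OF assms(1) refl refl], of "\<lambda>w. w x * u (?i w)"]
    by simp
  also have "\<dots> x = 0" for x
    using assms(3)[of x] inj by (simp add: the_inv_into_f_f)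
  finally have "(\<Sum>w\<in>set b. cscale (u (?i w)) w) = 0"
    by (auto simp: fun_eq_iff sum_cvec_apply cscale_def mult.commute)
  then have "u (?i (b ! t)) = 0"
    using assms(2,4) by (intro cvs.independentD[of "set b" "set b"]) auto
  then show ?thesis
    using inj assms(4) by (simp add: the_inv_into_f_f)
qed

lemma frame_length: "frame S b \<Longrightarrow> length b = cvs.dim S"
  by (metis cvs.dim_eq_card_independent cvs.dim_span distinct_card frame_def)

text \<open>The coordinates of one frame in terms of another form a square matrix, and every minor of the
  first frame is the corresponding minor of the second times the determinant of that matrix.\<close>

lemma plucker_frame_change:
  assumes "frame S b" "frame S c"
  obtains \<delta> where "\<delta> \<noteq> 0" "\<And>r. plucker c r = \<delta> * plucker b r"
proof -
  define m where "m = length b"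
  have len: "length c = m"
    using assms by (simp add: frame_length m_def)
  have "\<exists>u. \<forall>x. (c ! t) x = (\<Sum>s<m. (b ! s) x * u s)" if "t < m" for t
  proof -
    have "c ! t \<in> cvs.span (set b)"
      using assms that len by (metis cvs.span_base frame_def nth_mem)
    then show ?thesis
      using span_list_coefficients assms(1) unfolding frame_def m_def by metis
  qed
  then obtain a where a: "\<And>t x. t < m \<Longrightarrow> (c ! t) x = (\<Sum>s<m. (b ! s) x * a t s)"
    by metis
  define T where "T = mat m m (\<lambda>(s, t). a t s)"
  have T: "T \<in> carrier_mat m m"
    by (simp add: T_def)
  have "plucker c r = det T * plucker b r" for r
  proof -
    have "mat m m (\<lambda>(s, t). (c ! t) (r ! s)) = mat m m (\<lambda>(s, t). (b ! t) (r ! s)) * T"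
      by (rule eq_matI) (auto simp: T_def scalar_prod_def a atLeast0LessThan)
    then show ?thesis
      using T by (simp add: plucker_def len m_def[symmetric] det_mult[of _ m])
  qed
  moreover have "det T \<noteq> 0"
  proof
    \<comment> \<open>A vector in the kernel of \<open>T\<close> would be a linear relation between the members of \<open>c\<close>.\<close>
    assume "det T = 0"
    then obtain v where v: "v \<in> carrier_vec m" "v \<noteq> 0\<^sub>v m" "T *\<^sub>v v = 0\<^sub>v m"
      using det_0_iff_vec_prod_zero_field[OF T] by auto
    have Tv: "(\<Sum>t<m. a t s * v $ t) = 0" if "s < m" for s
    proof -
      have "(T *\<^sub>v v) $ s = (\<Sum>t<m. a t s * v $ t)"
        using that v(1) by (auto simp: T_def scalar_prod_def atLeast0LessThan)
      then show ?thesis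
        using v(3) that by simp
    qed
    have "(\<Sum>t<m. (c ! t) x * v $ t) = 0" for x
    proof -
      have "(\<Sum>t<m. (c ! t) x * v $ t) = (\<Sum>t<m. \<Sum>s<m. (b ! s) x * (a t s * v $ t))"
        by (auto simp: a sum_distrib_right mult.assoc intro!: sum.cong)
      also have "\<dots> = (\<Sum>s<m. (b ! s) x * (\<Sum>t<m. a t s * v $ t))"
        by (subst sum.swap) (simp add: sum_distrib_left)
      finally show ?thesis
        using Tv by simp
    qed
    then have "v $ t = 0" if "t < m" for t
      using independent_list_coefficients[of c "\<lambda>t. v $ t" t] assms(2) that
      by (simp add: len frame_def)
    then show False
      using v(1,2) by (metis carrier_vecD eq_vecI index_zero_vec)
  qed
  ultimately show ?thesis
    using that by blast
qed

definition delete_at :: "nat \<Rightarrow> 'a list \<Rightarrow> 'a list" where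
  "delete_at s r = take s r @ drop (Suc s) r"

lemma length_delete_at: "s < length r \<Longrightarrow> length (delete_at s r) = length r - 1"
  by (simp add: delete_at_def)

lemma set_delete_at: "set (delete_at s r) \<subseteq> set r"
  by (auto simp: delete_at_def dest: in_set_takeD in_set_dropD)

text \<open>Laplace expansion along the first column.\<close>

lemma plucker_Cons:
  assumes "length r = Suc (length b)"
  shows "plucker (v # b) r = (\<Sum>s<length r. (-1) ^ s * v (r ! s) * plucker b (delete_at s r))"
proof -
  let ?m = "length r"
  let ?A = "mat ?m ?m (\<lambda>(s, t). ((v # b) ! t) (r ! s))"
  have "cofactor ?A s 0 = (-1) ^ s * plucker b (delete_at s r)" if "s < ?m" for s
  proof -
    have "mat_delete ?A s 0 = mat (length b) (length b) (\<lambda>(s', t). (b ! t) (delete_at s r ! s'))"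
      using that assms
      by (intro eq_matI) (auto simp: mat_delete_def delete_at_def nth_append min_def)
    then show ?thesis
      by (simp add: cofactor_def plucker_def)
  qed
  moreover have "det ?A = (\<Sum>s<?m. ?A $$ (s, 0) * cofactor ?A s 0)"
    using assms by (intro laplace_expansion_column[where n = ?m]) auto
  ultimately have "det ?A = (\<Sum>s<?m. (-1) ^ s * v (r ! s) * plucker b (delete_at s r))"
    using assms by (auto intro!: sum.cong)
  then show ?thesis
    using assms by (simp add: plucker_def)
qed

text \<open>Iterating the Laplace expansion: prepending fixed vectors \<open>ks\<close> to a basis
  \<open>b\<close> turns its Pluecker coordinates into linear forms in the Pluecker coordinates of
  \<open>b\<close>, with coefficients that depend on \<open>ks\<close> only. The finite set \<open>C\<close>
  is an alphabet for the rows; fixing it in advance makes the summation range the same for all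
  \<open>r\<close>, so that the induction can interchange sums.\<close>

lemma plucker_append_linear:
  assumes "finite C"
  shows "\<exists>w. \<forall>r b. length r = length ks + d \<longrightarrow> set r \<subseteq> C \<longrightarrow> length b = d \<longrightarrow>
    plucker (ks @ b) r = (\<Sum>t | length t = d \<and> set t \<subseteq> C. w r t * plucker b t)"
proof -
  define T where "T = {t. length t = d \<and> set t \<subseteq> C}"
  have "finite T"
    using finite_lists_length_eq[OF assms, of d] unfolding T_def by (simp add: conj_commute)
  have "\<exists>w. \<forall>r b. length r = length ks + d \<longrightarrow> set r \<subseteq> C \<longrightarrow> length b = d \<longrightarrow>
      plucker (ks @ b) r = (\<Sum>t\<in>T. w r t * plucker b t)"
  proof (induction ks)
    case Nil
    have "plucker b r = (\<Sum>t\<in>T. (if t = r then 1 else 0) * plucker b t)" if "r \<in> T" for r b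
    proof -
      have "(\<Sum>t\<in>T. (if t = r then 1 else 0) * plucker b t)
          = (\<Sum>t\<in>T. if t = r then plucker b t else 0)"
        by (rule sum.cong) auto
      then show ?thesis
        using that \<open>finite T\<close> by simp
    qed
    then show ?case
      by (intro exI[of _ "\<lambda>r t. if t = r then 1 else 0"]) (auto simp: T_def)
  next
    case (Cons k ks)
    then obtain w where w: "\<And>r b. length r = length ks + d \<Longrightarrow> set r \<subseteq> C \<Longrightarrow> length b = d \<Longrightarrow>
        plucker (ks @ b) r = (\<Sum>t\<in>T. w r t * plucker b t)"
      by (elim exE conjE) blast
    let ?w = "\<lambda>r t. \<Sum>s<length r. (-1) ^ s * k (r ! s) * w (delete_at s r) t"
    have "plucker ((k # ks) @ b) r = (\<Sum>t\<in>T. ?w r t * plucker b t)"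
      if r: "length r = length (k # ks) + d" "set r \<subseteq> C" "length b = d" for r b
    proof -
      have "plucker ((k # ks) @ b) r
          = (\<Sum>s<length r. (-1) ^ s * k (r ! s) * plucker (ks @ b) (delete_at s r))"
        using r by (simp add: plucker_Cons)
      also have "\<dots> = (\<Sum>s<length r. \<Sum>t\<in>T.
          (-1) ^ s * k (r ! s) * w (delete_at s r) t * plucker b t)"
      proof (rule sum.cong[OF refl])
        fix s assume "s \<in> {..<length r}"
        then have "plucker (ks @ b) (delete_at s r)
            = (\<Sum>t\<in>T. w (delete_at s r) t * plucker b t)"
          using r set_delete_at[of s r] by (intro w) (auto simp: length_delete_at)
        then show "(-1) ^ s * k (r ! s) * plucker (ks @ b) (delete_at s r)
            = (\<Sum>t\<in>T. (-1) ^ s * k (r ! s) * w (delete_at s r) t * plucker b t)"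
          by (simp add: sum_distrib_left mult.assoc)
      qed
      also have "\<dots> = (\<Sum>t\<in>T. ?w r t * plucker b t)"
        by (subst sum.swap) (simp add: sum_distrib_right)
      finally show ?thesis .
    qed
    then show ?case
      by (intro exI[of _ ?w]) auto
  qed
  then show ?thesis
    by (simp add: T_def)
qed

text \<open>The matrix is block triangular with an identity block in the rows \<open>ks\<close>.\<close>

lemma plucker_units_append:
  assumes "distinct ks" "set ks \<inter> set r = {}" "length r = length b"
  shows "plucker (map unit ks @ b) (ks @ r) = plucker b r"
  using assms
proof (induction ks)
  case (Cons k ks)
  let ?r = "(k # ks) @ r"
  let ?f = "\<lambda>s. (-1) ^ s * unit k (?r ! s) * plucker (map unit ks @ b) (delete_at s ?r)"
  have "unit k ((ks @ r) ! s) = 0" if "s < length (ks @ r)" for s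
    using nth_mem[OF that] Cons.prems by (auto simp: unit_def)
  then have zero: "?f (Suc s) = 0" if "s < length (ks @ r)" for s
    using that by simp
  have "(\<Sum>s<length (ks @ r). ?f (Suc s)) = 0"
    by (rule sum.neutral) (use zero in blast)
  moreover have "unit k k = 1"
    by (simp add: unit_def)
  then have "?f 0 = plucker b r"
    using Cons by (simp add: delete_at_def)
  moreover have "plucker (map unit (k # ks) @ b) ?r = (\<Sum>s<Suc (length (ks @ r)). ?f s)"
    using Cons.prems(3) plucker_Cons[of ?r "map unit ks @ b" "unit k"] by simp
  ultimately show ?case
    unfolding sum.lessThan_Suc_shift by (simp only: add_0_right)
qed simp

lemma plucker_zero_row:
  assumes "k \<in> set r" "length r = length b" "\<And>v. v \<in> set b \<Longrightarrow> v k = 0"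
  shows "plucker b r = 0"
proof -
  let ?m = "length b"
  let ?A = "mat ?m ?m (\<lambda>(s, t). (b ! t) (r ! s))"
  obtain s where s: "s < ?m" "r ! s = k"
    using assms(1,2) by (metis in_set_conv_nth)
  have "det ?A = (\<Sum>t<?m. ?A $$ (s, t) * cofactor ?A s t)"
    using s by (intro laplace_expansion_row[where n = ?m]) auto
  also have "\<dots> = 0"
    using s assms(3) by (intro sum.neutral) auto
  finally show ?thesis
    by (simp add: plucker_def)
qed

lemma plucker_cong:
  assumes "length b' = length b" "length r' = length r" "length r = length b"
    and "\<And>s t. s < length r \<Longrightarrow> t < length b \<Longrightarrow> (b' ! t) (r' ! s) = (b ! t) (r ! s)"
  shows "plucker b' r' = plucker b r"
proof -
  have "mat (length b) (length b) (\<lambda>(s, t). (b' ! t) (r' ! s))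
      = mat (length b) (length b) (\<lambda>(s, t). (b ! t) (r ! s))"
    using assms by (intro eq_matI) auto
  then show ?thesis
    by (simp add: plucker_def assms(1))
qed

lemma frame_scale_Cons:
  assumes "frame S (v # b)" "\<delta> \<noteq> 0"
  shows "frame S (cscale \<delta> v # b)"
proof -
  have fr: "v \<notin> set b" "distinct b" "cvs.independent (insert v (set b))"
      "cvs.span (insert v (set b)) = S"
    using assms(1) by (auto simp: frame_def)
  have v: "v \<notin> cvs.span (set b)" and ind: "cvs.independent (set b)"
    using fr(1,3) by (auto simp: cvs.independent_insert)
  have "cscale (1 / \<delta>) (cscale \<delta> v) = v"
    using assms(2) by (simp add: cscale_def)
  then have sv: "cscale \<delta> v \<notin> cvs.span (set b)"
    using v cvs.span_scale by metis
  have "cvs.span (insert (cscale \<delta> v) (set b)) = S"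
  proof -
    have "(\<exists>k. x - cscale k (cscale \<delta> v) \<in> T) \<longleftrightarrow> (\<exists>k. x - cscale k v \<in> T)" for x T
    proof
      assume "\<exists>k. x - cscale k v \<in> T"
      then obtain k where "x - cscale k v \<in> T" ..
      moreover have "cscale (k / \<delta>) (cscale \<delta> v) = cscale k v"
        using assms(2) by simp
      ultimately show "\<exists>k. x - cscale k (cscale \<delta> v) \<in> T"
        by metis
    qed auto
    then show ?thesis
      using fr(4) by (simp only: cvs.span_insert)
  qed
  then show ?thesis
    using fr(2) cvs.independent_insertI[OF sv ind] cvs.span_base[of "cscale \<delta> v" "set b"] sv
    by (auto simp: frame_def)
qed

text \<open>Scaling one vector of a frame realizes an arbitrary nonzero common factor of the coordinates. The
  frame must be nonempty: the only frame of the zero space has the coordinate 1.\<close>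

lemma frame_rescale:
  assumes "frame S b" "b \<noteq> []" "\<delta> \<noteq> 0"
  obtains b' where "frame S b'" "length b' = length b"
    "\<And>r. length r = length b \<Longrightarrow> plucker b' r = \<delta> * plucker b r"
proof -
  obtain v bs where b: "b = v # bs"
    using assms(2) by (cases b) auto
  have "plucker (cscale \<delta> v # bs) r = \<delta> * plucker (v # bs) r" if "length r = Suc (length bs)" for r
    using that by (simp add: plucker_Cons cscale_def sum_distrib_left mult_ac del: sum.lessThan_Suc)
  then show ?thesis
    using that[of "cscale \<delta> v # bs"] frame_scale_Cons assms unfolding b by simp
qed

text \<open>If the coordinate \<open>k\<close> vanishes on \<open>S\<close>, then the span of \<open>S\<close>
  and \<open>unit k\<close> consists of the vectors that fall into \<open>S\<close> when this coordinate is
  erased.\<close>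

lemma frame_prepend_unit:
  assumes "frame S b" "\<And>v. v \<in> S \<Longrightarrow> v k = 0"
  shows "frame {w. w(k := 0) \<in> S} (unit k # b)"
proof -
  have S: "cvs.span (set b) = S" "distinct b" "cvs.independent (set b)"
    using assms(1) by (auto simp: frame_def)
  have "unit k \<notin> S"
    using assms(2)[of "unit k"] by (auto simp: unit_def)
  then have k: "unit k \<notin> cvs.span (set b)"
    by (simp add: S)
  moreover have "cvs.span (insert (unit k) (set b)) = {w. w(k := 0) \<in> S}"
  proof -
    have "w - cscale c (unit k) \<in> S \<Longrightarrow> c = w k" for w c
      using assms(2)[of "w - cscale c (unit k)"] by (auto simp: cscale_def unit_def)
    moreover have "w - cscale (w k) (unit k) = w(k := 0)" for w
      by (auto simp: cscale_def unit_def)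
    ultimately show ?thesis
      unfolding cvs.span_insert S by (metis (lifting))
  qed
  ultimately show ?thesis
    using S cvs.independent_insertI[OF k S(3)] cvs.span_base[of "unit k" "set b"]
    by (auto simp: frame_def)
qed

definition clear :: "nat set \<Rightarrow> cvec \<Rightarrow> cvec" where
  "clear K w = (\<lambda>s. if s \<in> K then 0 else w s)"

lemma frame_prepend_units:
  assumes "frame S b" "\<And>v k. v \<in> S \<Longrightarrow> k \<in> set ks \<Longrightarrow> v k = 0" "distinct ks"
  shows "frame {w. clear (set ks) w \<in> S} (map unit ks @ b)"
  using assms(2,3)
proof (induction ks)
  case Nil
  then show ?case using assms(1) by (simp add: clear_def)
next
  case (Cons k ks)
  have "clear (set ks) w k = w k" if "k \<notin> set ks" for w
    using that by (simp add: clear_def)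
  then have "frame {w. w(k := 0) \<in> {w. clear (set ks) w \<in> S}} (unit k # map unit ks @ b)"
    using Cons.IH Cons.prems by (intro frame_prepend_unit) (simp_all, metis)
  moreover have "clear (set ks) (w(k := 0)) = clear (set (k # ks)) w" for w
    by (auto simp: clear_def)
  ultimately show ?case
    by simp
qed

lemma frame_Nil: "frame {0} []"
  by (simp add: frame_def cvs.independent_empty)

lemma frame_units:
  assumes "distinct ks"
  shows "frame {w. \<forall>s. s \<notin> set ks \<longrightarrow> w s = 0} (map unit ks)"
proof -
  have "{w. \<forall>s. s \<notin> set ks \<longrightarrow> w s = 0} = {w. clear (set ks) w \<in> {0}}"
    by (auto simp: clear_def fun_eq_iff)
  then show ?thesis
    using frame_prepend_units[OF frame_Nil, of ks] assms by simp
qed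

lemma frame_coord_space: "frame (coord_space m) (map unit [1..<Suc m])"
  using frame_units[of "[1..<Suc m]"]
  by (simp add: coord_space_def atLeastLessThanSuc_atLeastAtMost del: upt_Suc)

lemma frame_subspace: "frame S b \<Longrightarrow> cvs.subspace S"
  by (auto simp: frame_def)

lemma frame_in_Gr: "frame S b \<Longrightarrow> S \<subseteq> E \<Longrightarrow> length b = d \<Longrightarrow> S \<in> Gr d E"
  using frame_length[of S b] by (auto simp: Gr_def frame_subspace)

text \<open>The hypothesis on \<open>S\<close> provides finite dimension, which is needed to arrange a basis
  as a list.\<close>

lemma obtain_frame:
  assumes "cvs.subspace S" "S \<subseteq> coord_space m"
  obtains b where "frame S b"
proof -
  obtain B where B: "B \<subseteq> S" "cvs.independent B" "S \<subseteq> cvs.span B"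
    using cvs.maximal_independent_subset by blast
  have "B \<subseteq> cvs.span (set (map unit [1..<Suc m]))"
    using B(1) assms(2) frame_coord_space[of m] by (auto simp: frame_def)
  then have "finite B"
    using cvs.independent_span_bound[OF _ B(2)] by blast
  then obtain b where b: "set b = B" "distinct b"
    using finite_distinct_list by blast
  have "cvs.span B = S"
    using B assms(1) by (metis cvs.span_minimal subset_antisym)
  then show ?thesis
    using that B b unfolding frame_def by metis
qed

section \<open>A criterion for morphisms\<close>

text \<open>Pluecker coordinates are determined up to one nonzero factor for each Grassmannian.\<close>

lemma plucker_coords_rescaled:
  assumes "p \<in> plucker_coords X x" "q \<in> plucker_coords X x"
  obtains c where "\<And>i. i \<in> factors X \<Longrightarrow> c i \<noteq> 0"
    and "\<And>i r. i \<in> factors X \<Longrightarrow> q (i, r) = c i * p (i, r)"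
proof -
  obtain b b' where b: "\<And>i. i \<in> factors X \<Longrightarrow> frame (x i) (b i)" "p = (\<lambda>(i, r). plucker (b i) r)"
    and b': "\<And>i. i \<in> factors X \<Longrightarrow> frame (x i) (b' i)" "q = (\<lambda>(i, r). plucker (b' i) r)"
    using assms unfolding plucker_coords_def by blast
  have "\<exists>\<delta>. \<delta> \<noteq> 0 \<and> (\<forall>r. q (i, r) = \<delta> * p (i, r))" if i: "i \<in> factors X" for i
  proof -
    obtain \<delta> where "\<delta> \<noteq> 0" "\<And>r. plucker (b' i) r = \<delta> * plucker (b i) r"
      using plucker_frame_change[OF b(1)[OF i] b'(1)[OF i]] by blast
    then show ?thesis
      by (auto simp: b(2) b'(2))
  qed
  then show ?thesis
    using that by metis
qed

lemma multihom_nonzero_well_defined: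
  assumes "finite (factors X)" "multihom (plucker_vars X) D P"
    and "p \<in> plucker_coords X x" "q \<in> plucker_coords X x" "P p \<noteq> 0"
  shows "P q \<noteq> 0"
proof -
  obtain c where c: "\<And>i. i \<in> factors X \<Longrightarrow> c i \<noteq> 0"
    "\<And>i r. i \<in> factors X \<Longrightarrow> q (i, r) = c i * p (i, r)"
    using plucker_coords_rescaled[OF assms(3,4)] by blast
  have "P q = (\<Prod>i\<in>factors X. c i ^ D i) * P p"
    using assms(1,2) c(2) by (intro multihom_rescale) (auto simp: plucker_vars_def)
  then show ?thesis
    using c(1) assms(1,5) by simp
qed

lemma multihom_cong:
  assumes "finite (factors X)" "multihom (plucker_vars X) D P"
    and "\<And>v. v \<in> plucker_vars X \<Longrightarrow> q v = p v"
  shows "P q = P p"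
proof -
  have "fst ` plucker_vars X \<subseteq> factors X"
    by (auto simp: plucker_vars_def)
  then show ?thesis
    using multihom_rescale[OF assms(2,1), of q "\<lambda>_. 1" p] assms(3) by simp
qed

text \<open>A map is a morphism if the Pluecker coordinates of the image are given by multihomogeneous forms
  in those of the argument. Substituting these forms pulls principal open sets back to principal open sets and
  fractions to fractions. Regularity is tested on all coordinate vectors of a point, so the forms must map
  each coordinate vector of \<open>x\<close> to an actual coordinate vector of \<open>\<phi> x\<close>, that
  is, one that comes from bases; this is the last hypothesis. Existence of frames excludes points without
  coordinate vectors, which would lie in every principal open set.\<close>

lemma morphismI:
  assumes fin: "finite (factors X)" "finite (factors Y)"
    and maps: "\<And>x. x \<in> points X \<Longrightarrow> \<phi> x \<in> points Y"
    and nonempty: "\<And>x i. x \<in> points X \<Longrightarrow> i \<in> factors X \<Longrightarrow> \<exists>b. frame (x i) b"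
    and homogeneous: "\<And>j r. (j, r) \<in> plucker_vars Y \<Longrightarrow> multihom (plucker_vars X) (E j) (L (j, r))"
    and frames: "\<And>x b j. x \<in> points X \<Longrightarrow> (\<And>i. i \<in> factors X \<Longrightarrow> frame (x i) (b i)) \<Longrightarrow>
      j \<in> factors Y \<Longrightarrow> \<exists>b'. frame (\<phi> x j) b' \<and>
        (\<forall>r. (j, r) \<in> plucker_vars Y \<longrightarrow> plucker b' r = L (j, r) (\<lambda>(i, r). plucker (b i) r))"
  shows "morphism X Y \<phi>"
proof -
  define pull where "pull P = (\<lambda>p. P (\<lambda>v. L v p))" for P :: "('b \<times> nat list \<Rightarrow> complex) \<Rightarrow> complex"
  define deg where "deg D = (\<lambda>i. \<Sum>j\<in>factors Y. D j * E j i)" for D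
  have hom: "multihom (plucker_vars X) (deg D) (pull P)" if "multihom (plucker_vars Y) D P" for D P
    unfolding pull_def deg_def using that fin(2)
  proof (rule multihom_compose)
    show "fst ` plucker_vars Y \<subseteq> factors Y"
      by (auto simp: plucker_vars_def)
  qed (rule homogeneous)
  have coords: "\<exists>q\<in>plucker_coords Y (\<phi> x). \<forall>D P. multihom (plucker_vars Y) D P \<longrightarrow> P q = pull P p"
    if x: "x \<in> points X" and p: "p \<in> plucker_coords X x" for x p
  proof -
    obtain b where b: "\<And>i. i \<in> factors X \<Longrightarrow> frame (x i) (b i)" "p = (\<lambda>(i, r). plucker (b i) r)"
      using p unfolding plucker_coords_def by blast
    have "\<forall>j\<in>factors Y. \<exists>b'. frame (\<phi> x j) b' \<and>
        (\<forall>r. (j, r) \<in> plucker_vars Y \<longrightarrow> plucker b' r = L (j, r) p)"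
      using frames[OF x b(1)] by (simp add: b(2))
    then obtain b' where b': "\<And>j. j \<in> factors Y \<Longrightarrow> frame (\<phi> x j) (b' j)"
      "\<And>j r. j \<in> factors Y \<Longrightarrow> (j, r) \<in> plucker_vars Y \<Longrightarrow> plucker (b' j) r = L (j, r) p"
      by (auto dest!: bchoice)
    let ?q = "\<lambda>(j, r). plucker (b' j) r"
    have "?q \<in> plucker_coords Y (\<phi> x)"
      using b'(1) unfolding plucker_coords_def by blast
    moreover have "P ?q = pull P p" if "multihom (plucker_vars Y) D P" for D P
      unfolding pull_def using that fin(2) b'(2)
      by (intro multihom_cong[of Y D P]) (auto simp: plucker_vars_def)
    ultimately show ?thesis
      by blast
  qed
  have vanish: "(\<forall>q\<in>plucker_coords Y (\<phi> x). P q \<noteq> 0) \<longleftrightarrow> (\<forall>p\<in>plucker_coords X x. pull P p \<noteq> 0)"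
    if x: "x \<in> points X" and P: "multihom (plucker_vars Y) D P" for x D P
  proof -
    have "\<forall>i\<in>factors X. \<exists>b. frame (x i) b"
      using x nonempty by blast
    then obtain b where "\<forall>i\<in>factors X. frame (x i) (b i)"
      by (metis bchoice)
    then obtain p where p: "p \<in> plucker_coords X x"
      unfolding plucker_coords_def by blast
    show ?thesis
    proof
      assume nz: "\<forall>q\<in>plucker_coords Y (\<phi> x). P q \<noteq> 0"
      show "\<forall>p\<in>plucker_coords X x. pull P p \<noteq> 0"
      proof
        fix p assume "p \<in> plucker_coords X x"
        then obtain q where "q \<in> plucker_coords Y (\<phi> x)" "P q = pull P p"
          using coords[OF x] P by blast
        then show "pull P p \<noteq> 0"
          using nz by force
      qed
    next
      assume nz: "\<forall>p\<in>plucker_coords X x. pull P p \<noteq> 0"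
      obtain q where q: "q \<in> plucker_coords Y (\<phi> x)" "P q = pull P p"
        using coords[OF x p] P by blast
      then have "P q \<noteq> 0"
        using nz p by simp
      then show "\<forall>q\<in>plucker_coords Y (\<phi> x). P q \<noteq> 0"
        using multihom_nonzero_well_defined[OF fin(2) P q(1)] by blast
    qed
  qed
  have pre: "\<phi> -` principal_open Y P \<inter> points X = principal_open X (pull P)"
    if P: "multihom (plucker_vars Y) D P" for D P
    using vanish[OF _ P] maps by (auto simp: principal_open_def)
  have cont: "continuous_map (zariski X) (zariski Y) \<phi>"
    unfolding zariski_def[of Y] continuous_on_generated_topo_iff topspace_zariski
  proof (intro conjI allI impI)
    fix U assume "U \<in> {principal_open Y P |P. \<exists>D. multihom (plucker_vars Y) D P}"
    then obtain P D where U: "U = principal_open Y P" and P: "multihom (plucker_vars Y) D P"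
      by blast
    have "openin (zariski X) (principal_open X (pull P))"
      unfolding zariski_def using hom[OF P] by (intro topology_generated_by_Basis) blast
    then show "openin (zariski X) (\<phi> -` U \<inter> points X)"
      by (simp add: U pre[OF P])
  next
    have "principal_open Y (\<lambda>_. 1) = points Y"
      by (auto simp: principal_open_def)
    then show "\<phi> ` points X \<subseteq> \<Union> {principal_open Y P |P. \<exists>D. multihom (plucker_vars Y) D P}"
      using maps multihom.const[of "plucker_vars Y" 1] by blast
  qed
  have "regular_on X {x \<in> points X. \<phi> x \<in> U} (f \<circ> \<phi>)" if reg: "regular_on Y U f" for U f
    unfolding regular_on_def
  proof (intro conjI ballI)
    have pre_open: "openin (zariski X) {x \<in> points X. \<phi> x \<in> O'}" if "openin (zariski Y) O'" for O'
      using openin_continuous_map_preimage[OF cont that] by simp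
    then show "openin (zariski X) {x \<in> points X. \<phi> x \<in> U}"
      using reg by (simp add: regular_on_def)
    fix x assume x: "x \<in> {x \<in> points X. \<phi> x \<in> U}"
    then have "\<phi> x \<in> U"
      by simp
    moreover have "\<forall>x\<in>U. \<exists>O' D P Q. openin (zariski Y) O' \<and> x \<in> O' \<and> O' \<subseteq> U \<and>
        multihom (plucker_vars Y) D P \<and> multihom (plucker_vars Y) D Q \<and>
        (\<forall>y\<in>O'. \<forall>p\<in>plucker_coords Y y. Q p \<noteq> 0 \<and> f y = P p / Q p)"
      using reg unfolding regular_on_def by (rule conjunct2)
    ultimately have "\<exists>O' D P Q. openin (zariski Y) O' \<and> \<phi> x \<in> O' \<and> O' \<subseteq> U \<and>
        multihom (plucker_vars Y) D P \<and> multihom (plucker_vars Y) D Q \<and>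
        (\<forall>y\<in>O'. \<forall>p\<in>plucker_coords Y y. Q p \<noteq> 0 \<and> f y = P p / Q p)"
      by (rule bspec[rotated])
    then obtain O' D P Q where O': "openin (zariski Y) O'" "\<phi> x \<in> O'" "O' \<subseteq> U"
      and PQ: "multihom (plucker_vars Y) D P" "multihom (plucker_vars Y) D Q"
      and f: "\<And>y q. y \<in> O' \<Longrightarrow> q \<in> plucker_coords Y y \<Longrightarrow> Q q \<noteq> 0 \<and> f y = P q / Q q"
      by (elim exE conjE) blast
    let ?O = "{x \<in> points X. \<phi> x \<in> O'}"
    have "pull Q p \<noteq> 0 \<and> (f \<circ> \<phi>) y = pull P p / pull Q p"
      if y: "y \<in> ?O" "p \<in> plucker_coords X y" for y p
    proof -
      have "y \<in> points X"
        using y(1) by simp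
      from coords[OF this y(2)] obtain q where "q \<in> plucker_coords Y (\<phi> y)"
          and "\<forall>D P. multihom (plucker_vars Y) D P \<longrightarrow> P q = pull P p" ..
      moreover from this have "P q = pull P p" "Q q = pull Q p"
        using PQ by simp_all
      ultimately show ?thesis
        using f[of "\<phi> y" q] y(1) by simp
    qed
    then show "\<exists>O' D P Q. openin (zariski X) O' \<and> x \<in> O' \<and> O' \<subseteq> {x \<in> points X. \<phi> x \<in> U} \<and>
        multihom (plucker_vars X) D P \<and> multihom (plucker_vars X) D Q \<and>
        (\<forall>y\<in>O'. \<forall>p\<in>plucker_coords X y. Q p \<noteq> 0 \<and> (f \<circ> \<phi>) y = P p / Q p)"
      using pre_open[OF O'(1)] O'(2,3) x hom[OF PQ(1)] hom[OF PQ(2)]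
      by (intro exI[of _ ?O] exI[of _ "deg D"] exI[of _ "pull P"] exI[of _ "pull Q"]) auto
  qed
  then show ?thesis
    using cont by (simp add: morphism_def)
qed

section \<open>The enumeration of the pairs by diagonals\<close>

text \<open>The number of pairs on the first \<open>b\<close> diagonals: the steps run through the diagonals
  \<open>j - i = n - 1, n - 2, \<dots>, 0\<close>, and the diagonal \<open>j - i = n - 1 - b\<close> consists
  of \<open>b + 1\<close> pairs.\<close>

definition triangle :: "nat \<Rightarrow> nat" where
  "triangle b = b * (b + 1) div 2"

lemma triangle_0: "triangle 0 = 0"
  by (simp add: triangle_def)

lemma triangle_Suc: "triangle (Suc b) = triangle b + b + 1"
proof -
  have "Suc b * (Suc b + 1) = b * (b + 1) + 2 * (b + 1)"
    by (simp add: algebra_simps)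
  then show ?thesis
    by (simp add: triangle_def)
qed

lemma triangle_mono: "a \<le> b \<Longrightarrow> triangle a \<le> triangle b"
  unfolding triangle_def by (intro div_le_mono mult_le_mono) simp_all

lemma N_of_eq_triangle: "N_of n = triangle n"
  by (simp add: N_of_def triangle_def choose_two mult.commute)

lemma step_in_diagonal:
  assumes "1 \<le> k"
  shows "\<exists>b i. k = triangle b + i \<and> 1 \<le> i \<and> i \<le> b + 1"
  using assms
proof (induction k rule: dec_induct)
  case base
  show ?case
    by (intro exI[of _ 0] exI[of _ 1]) (simp add: triangle_0)
next
  case (step k)
  then obtain b i where k: "k = triangle b + i" "1 \<le> i" "i \<le> b + 1"
    by blast
  show ?case
  proof (cases "i = b + 1")
    case True
    then show ?thesis
      using k by (intro exI[of _ "Suc b"] exI[of _ 1]) (simp add: triangle_Suc)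
  next
    case False
    then show ?thesis
      using k by (intro exI[of _ b] exI[of _ "Suc i"]) simp
  qed
qed

text \<open>The recursion is followed backwards: the predecessor of the first pair of a diagonal is the last
  pair of the previous one, the only pair there with \<open>j = n\<close>.\<close>

lemma beta_diagonal:
  assumes "1 \<le> i" "i \<le> b + 1" "b < n"
  shows "beta n (triangle b + i) = (i, n - 1 - b + i)"
proof -
  have beta_Suc: "beta n (Suc k) = beta_step n (beta n k)" if "1 \<le> k" for k
    using that by (cases k) (simp_all add: beta_def)
  have "\<forall>b i. k = triangle b + i \<longrightarrow> 1 \<le> i \<longrightarrow> i \<le> b + 1 \<longrightarrow> b < n \<longrightarrow>
      beta n k = (i, n - 1 - b + i)" if "1 \<le> k" for k
    using that
  proof (induction k rule: dec_induct)
    case base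
    show ?case
    proof (intro allI impI)
      fix b i assume "1 = triangle b + i" "1 \<le> i"
      then have "b = 0" "i = 1"
        by (cases b; simp add: triangle_Suc triangle_0)+
      then show "beta n 1 = (i, n - 1 - b + i)" if "b < n"
        using that by (simp add: beta_def)
    qed
  next
    case (step k)
    show ?case
    proof (intro allI impI)
      fix b i assume k: "Suc k = triangle b + i" "1 \<le> i" "i \<le> b + 1" "b < n"
      show "beta n (Suc k) = (i, n - 1 - b + i)"
      proof (cases "i = 1")
        case True
        then obtain a where a: "b = Suc a"
          using k(1) step.hyps by (cases b) (auto simp: triangle_0)
        then have "beta n k = (a + 1, n - 1 - a + (a + 1))"
          using k step.IH[rule_format, of a "a + 1"] True by (auto simp: triangle_Suc)
        then show ?thesis
          using a k True beta_Suc[OF step.hyps(1)]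
          by (auto simp: beta_step_def)
      next
        case False
        then have "k = triangle b + (i - 1)" "1 \<le> i - 1" "i - 1 \<le> b + 1"
          using k by auto
        then have "beta n k = (i - 1, n - 1 - b + (i - 1))"
          using step.IH[rule_format, of b "i - 1"] k(4) by blast
        then show ?thesis
          using False k beta_Suc[OF step.hyps(1)]
          by (auto simp: beta_step_def)
      qed
    qed
  qed
  then show ?thesis
    using assms trans_le_add2[OF assms(1)] by blast
qed

lemma step_cases:
  assumes "1 \<le> k" "k \<le> N_of n"
  obtains b i where "k = triangle b + i" "1 \<le> i" "i \<le> b + 1" "b < n"
proof -
  obtain b i where k: "k = triangle b + i" "1 \<le> i" "i \<le> b + 1"
    using step_in_diagonal[OF assms(1)] by blast
  have "b < n"
    using triangle_mono[of n b] k assms(2) by (fastforce simp: N_of_eq_triangle)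
  then show ?thesis
    using that k by blast
qed

text \<open>The number \<open>k\<close> with \<open>\<beta>\<^sub>k =
  \<alpha>\<^bsub>i,j\<^esub>\<close>.\<close>

definition time :: "nat \<Rightarrow> nat \<Rightarrow> nat \<Rightarrow> nat" where
  "time n i j = triangle (n - 1 - (j - i)) + i"

lemma time_beta:
  assumes "(i, j) \<in> R_indices n"
  shows "time n i j \<in> {1..N_of n}" "beta n (time n i j) = (i, j)" "ell n (time n i j) = i + j - 1"
proof -
  define b where "b = n - 1 - (j - i)"
  have ij: "1 \<le> i" "i \<le> j" "j \<le> n"
    using assms by (auto simp: R_indices_def)
  then have b: "i \<le> b + 1" "b < n" "n - 1 - b + i = j"
    unfolding b_def by auto
  have "triangle b + i \<le> triangle n"
    using triangle_mono[of "Suc b" n] b by (simp add: triangle_Suc)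
  then show "time n i j \<in> {1..N_of n}"
    using ij unfolding time_def b_def[symmetric] by (simp add: N_of_eq_triangle)
  show *: "beta n (time n i j) = (i, j)"
    using beta_diagonal[of i b n] ij b unfolding time_def b_def[symmetric] by simp
  show "ell n (time n i j) = i + j - 1"
    by (simp add: ell_def *)
qed

lemma beta_time:
  assumes "1 \<le> k" "k \<le> N_of n" "beta n k = (i, j)"
  shows "(i, j) \<in> R_indices n" "time n i j = k"
proof -
  obtain b i' where k: "k = triangle b + i'" "1 \<le> i'" "i' \<le> b + 1" "b < n"
    using step_cases assms(1,2) by blast
  then have ij: "i = i'" "j = n - 1 - b + i'"
    using beta_diagonal[of i' b n] assms(3) by auto
  then show "(i, j) \<in> R_indices n"
    using k by (auto simp: R_indices_def)
  have "n - 1 - (j - i) = b"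
    using ij k by auto
  then show "time n i j = k"
    by (simp add: time_def k ij)
qed

section \<open>The lattice path of a flag\<close>

text \<open>The pair that occupies position \<open>m\<close> of the \<open>k\<close>-th flag: the pair treated
  by the last step that has changed this position, or else a boundary pair, \<open>(0, m + 1)\<close> for
  \<open>m \<le> n\<close> and \<open>(m - n, n + 1)\<close> for \<open>m > n\<close>. Both cases are covered
  by the one formula because \<open>m - n\<close> is truncated.\<close>

fun cell :: "nat \<Rightarrow> nat \<Rightarrow> nat \<Rightarrow> nat \<times> nat" where
  "cell n 0 m = (m - n, m + 1 - (m - n))"
| "cell n (Suc k) m = (if m = ell n (Suc k) then beta n (Suc k) else cell n k m)"

text \<open>The first entry of the pair at position \<open>m\<close> once all pairs with \<open>j - i \<ge>
  d\<close> have been treated. Since \<open>i + j = m + 1\<close>, it is the largest \<open>i\<close> with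
  \<open>j - i \<ge> d\<close>, except near the end, where \<open>j \<le> n + 1\<close> forces \<open>i \<ge>
  m - n\<close>. Near the start, truncated subtraction keeps the value at 0.\<close>

definition zigzag :: "nat \<Rightarrow> nat \<Rightarrow> nat \<Rightarrow> nat" where
  "zigzag n d m = max (m - n) ((m + 1 - d) div 2)"

lemma zigzag_start: "m < d \<Longrightarrow> d \<le> n \<Longrightarrow> zigzag n d m = 0"
  by (simp add: zigzag_def)

lemma zigzag_end: "m + 1 - d \<le> 2 * (m - n) + 1 \<Longrightarrow> zigzag n d m = m - n"
  unfolding zigzag_def by linarith

text \<open>After \<open>i\<close> steps on the diagonal \<open>d = n - 1 - b\<close> the path follows the
  zigzag of \<open>d\<close> up to the position \<open>d + 2 * i - 1\<close> of the last step and that of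
  \<open>d + 1\<close> from there on. Allowing \<open>i = 0\<close> makes the end of one diagonal and the
  start of the next two descriptions of the same state.\<close>

lemma cell_eq_zigzag:
  assumes "i \<le> b + 1" "b < n" "m \<in> {1..2 * n - 1}"
    and "z = zigzag n (if m + b + 2 \<le> n + 2 * i then n - 1 - b else n - b) m"
  shows "cell n (triangle b + i) m = (z, m + 1 - z)"
proof -
  define Z where "Z b i m = zigzag n (if m + b + 2 \<le> n + 2 * i then n - 1 - b else n - b) m" for b i m
  have block: "\<forall>i\<le>b + 1. \<forall>m\<in>{1..2 * n - 1}. cell n (triangle b + i) m = (Z b i m, m + 1 - Z b i m)"
    if start: "\<forall>m\<in>{1..2 * n - 1}. cell n (triangle b) m = (Z b 0 m, m + 1 - Z b 0 m)" and b: "b < n" for b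
  proof (intro allI impI)
    fix i assume "i \<le> b + 1"
    then show "\<forall>m\<in>{1..2 * n - 1}. cell n (triangle b + i) m = (Z b i m, m + 1 - Z b i m)"
    proof (induction i)
      case 0
      then show ?case using start by simp
    next
      case (Suc i)
      have beta: "beta n (Suc (triangle b + i)) = (Suc i, n - b + i)"
        using beta_diagonal[of "Suc i" b n] Suc.prems b by auto
      then have ell: "ell n (Suc (triangle b + i)) = n - b + 2 * i"
        by (simp add: ell_def)
      show ?case
      proof
        fix m assume m: "m \<in> {1..2 * n - 1}"
        show "cell n (triangle b + Suc i) m = (Z b (Suc i) m, m + 1 - Z b (Suc i) m)"
        proof (cases "m = n - b + 2 * i")
          case True
          then have "Z b (Suc i) m = Suc i"
            using Suc.prems b by (auto simp: Z_def zigzag_def)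
          then show ?thesis
            using True by (simp add: beta ell)
        next
          case False
          have "Z b (Suc i) m = Z b i m"
          \<comment> \<open>The position just below the step changes its zigzag but not its value.\<close>
          proof (cases "m + b + 1 = n + 2 * i")
            case True
            have "n = n - 1 - b + b + 1"
              using b by simp
            then obtain c where n: "n = c + b + 1"
              by blast
            have "m = c + 2 * i"
              using True by (simp add: n)
            then have "(m + 1 - (n - 1 - b)) div 2 = (m + 1 - (n - b)) div 2"
              by (simp add: n)
            moreover have "m + b + 2 \<le> n + 2 * Suc i" "\<not> m + b + 2 \<le> n + 2 * i"
              using True by auto
            ultimately show ?thesis
              unfolding Z_def zigzag_def by (simp only: if_True if_False)
          next
            case neq: False
            then have "(m + b + 2 \<le> n + 2 * Suc i) = (m + b + 2 \<le> n + 2 * i)"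
              using False b by auto
            then show ?thesis
              by (simp add: Z_def)
          qed
          then show ?thesis
            using False Suc m by (simp add: ell)
        qed
      qed
    qed
  qed
  have "\<forall>m\<in>{1..2 * n - 1}. cell n (triangle b) m = (Z b 0 m, m + 1 - Z b 0 m)" if "b < n" for b
    using that
  proof (induction b)
    case 0
    have "Z 0 0 m = m - n" for m
      unfolding Z_def by (rule zigzag_end) auto
    then show ?case
      by (simp add: triangle_0)
  next
    case (Suc b)
    have "Z (Suc b) 0 m = Z b (b + 1) m" for m
    proof -
      consider "m + b + 3 \<le> n" | "n < m + b + 3" "m \<le> n + b" | "n + b < m"
        by linarith
      then show ?thesis
      proof cases
        case 1
        then show ?thesis
          by (simp add: Z_def zigzag_start)
      next
        case 2
        then have "n - 1 - b = n - Suc b" by simp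
        then show ?thesis
          using 2 by (simp add: Z_def)
      next
        case 3
        then have "zigzag n (n - Suc b) m = m - n" "zigzag n (n - b) m = m - n"
          using Suc.prems by (auto intro!: zigzag_end)
        then show ?thesis
          using 3 by (simp add: Z_def)
      qed
    qed
    moreover have "triangle (Suc b) = triangle b + (b + 1)"
      by (simp add: triangle_Suc)
    moreover have "\<forall>i\<le>b + 1. \<forall>m\<in>{1..2 * n - 1}.
        cell n (triangle b + i) m = (Z b i m, m + 1 - Z b i m)"
      using Suc by (intro block) simp_all
    then have "\<forall>m\<in>{1..2 * n - 1}.
        cell n (triangle b + (b + 1)) m = (Z b (b + 1) m, m + 1 - Z b (b + 1) m)"
      by blast
    ultimately show ?case
      by (simp only:)
  qed
  then show ?thesis
    using block assms by (simp add: Z_def)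
qed

lemma cell_bounds:
  assumes "k \<le> N_of n" "m \<in> {1..2 * n - 1}" "cell n k m = (i, j)"
  shows "i + j = m + 1" "i \<le> j" "j \<le> n + 1" "1 \<le> j" "i \<le> n"
proof -
  have "n > 0"
    using assms(2) by auto
  have "\<exists>d. i = zigzag n d m \<and> j = m + 1 - zigzag n d m"
  proof (cases "k = 0")
    case True
    moreover have "zigzag n n m = m - n"
      by (rule zigzag_end) auto
    ultimately have "cell n k m = (zigzag n n m, m + 1 - zigzag n n m)"
      by simp
    then show ?thesis
      using assms(3) by auto
  next
    case False
    then obtain b i' where "k = triangle b + i'" "1 \<le> i'" "i' \<le> b + 1" "b < n"
      using step_cases[of k n] assms(1) by (metis less_one linorder_not_le)
    then show ?thesis
      using cell_eq_zigzag[of i' b n m] assms(2,3) by auto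
  qed
  then obtain d where d: "i = zigzag n d m" "j = m + 1 - i"
    by blast
  have m: "1 \<le> m" "m < 2 * n"
    using assms(2) by auto
  have "m - n \<le> i" "2 * i \<le> max (2 * (m - n)) (m + 1)"
    unfolding d(1) zigzag_def by linarith+
  then show "i + j = m + 1" "i \<le> j" "j \<le> n + 1" "1 \<le> j" "i \<le> n"
    using m d(2) by linarith+
qed

lemma zigzag_step:
  assumes "d' = d \<or> d' = d + 1"
  shows "zigzag n d' (m + 1) = zigzag n d m \<or> zigzag n d' (m + 1) = zigzag n d m + 1"
proof -
  have "m + 1 + 1 - d' = m + 1 - d \<or> m + 1 + 1 - d' = m + 1 - d + 1"
    using assms by linarith
  moreover have "(x + 1) div 2 = x div 2 \<or> (x + 1) div 2 = x div 2 + 1" for x :: nat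
    by linarith
  ultimately have "(m + 1 + 1 - d') div 2 = (m + 1 - d) div 2 \<or>
      (m + 1 + 1 - d') div 2 = (m + 1 - d) div 2 + 1"
    by metis
  moreover have "m + 1 - n = m - n \<or> m + 1 - n = m - n + 1"
    by linarith
  moreover have "max p' q' = max p q \<or> max p' q' = max p q + 1"
    if "p' = p \<or> p' = p + 1" "q' = q \<or> q' = q + 1" for p q p' q' :: nat
    using that by linarith
  ultimately show ?thesis
    unfolding zigzag_def by blast
qed

text \<open>The pairs along a flag form a lattice path with unit steps. This turns the inclusions inside a
  flag into the two kinds of inclusions that define \<open>R n\<close>.\<close>

lemma cell_adjacent:
  assumes "k \<le> N_of n" "1 \<le> m" "m < 2 * n - 1" "cell n k m = (i, j)"
  shows "cell n k (m + 1) = (i + 1, j) \<or> cell n k (m + 1) = (i, j + 1)"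
proof -
  have "n > 0"
    using assms(3) by auto
  obtain b i' where k: "k = triangle b + i'" "i' \<le> b + 1" "b < n"
    using step_cases[of k n] assms(1) \<open>n > 0\<close>
    by (metis add.right_neutral bot_nat_0.extremum less_one linorder_not_le triangle_0)
  define d where "d m = (if m + b + 2 \<le> n + 2 * i' then n - 1 - b else n - b)" for m
  have c: "cell n k m' = (zigzag n (d m') m', m' + 1 - zigzag n (d m') m')" if "m' \<in> {1..2 * n - 1}" for m'
    using cell_eq_zigzag[OF k(2,3) that] by (simp add: k(1) d_def)
  have "d (m + 1) = d m \<or> d (m + 1) = d m + 1"
    using k(3) by (auto simp: d_def)
  then have "zigzag n (d (m + 1)) (m + 1) = zigzag n (d m) m \<or>
      zigzag n (d (m + 1)) (m + 1) = zigzag n (d m) m + 1"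
    by (rule zigzag_step)
  moreover have "zigzag n (d m) m \<le> m"
    using assms(2) by (auto simp: zigzag_def)
  ultimately show ?thesis
    using c[of m] c[of "m + 1"] assms by auto
qed

lemma cell_final:
  assumes "i \<in> {1..n}"
  shows "cell n (N_of n) (2 * i - 1) = (i, i)"
proof -
  have "N_of n = triangle (n - 1) + n"
    using assms triangle_Suc[of "n - 1"] by (simp add: N_of_eq_triangle)
  moreover have "zigzag n 0 (2 * i - 1) = i"
    using assms by (auto simp: zigzag_def)
  moreover have "2 * i - 1 + (n - 1) + 2 \<le> n + 2 * n"
    using assms by auto
  moreover have "2 * i - 1 \<in> {1..2 * n - 1}" "2 * i - 1 + 1 - i = i"
    using assms by auto
  ultimately show ?thesis
    using cell_eq_zigzag[of n "n - 1" n "2 * i - 1" i] assms by simp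
qed

text \<open>When a pair is treated, its neighbours on the path are \<open>(i - 1, j)\<close> and \<open>(i, j
  + 1)\<close>: a corner of the path has just been flipped. Hence each of the two inclusions required of
  \<open>(i, j)\<close> is seen in some flag.\<close>

lemma cell_at_time:
  assumes "(i, j) \<in> R_indices n"
  shows "cell n (time n i j) (i + j - 1) = (i, j)"
    and "2 \<le> i + j - 1 \<Longrightarrow> cell n (time n i j) (i + j - 2) = (i - 1, j)"
    and "i + j - 1 < 2 * n - 1 \<Longrightarrow> cell n (time n i j) (i + j) = (i, j + 1)"
proof -
  have ij: "1 \<le> i" "i \<le> j" "j \<le> n"
    using assms by (auto simp: R_indices_def)
  then have "i = i - 1 + 1" "j = i - 1 + 1 + (j - i)" "n = n - 1 - (j - i) + 1 + (j - i)"
    "i - 1 \<le> n - 1 - (j - i)"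
    by simp_all
  then obtain p d b where i: "i = p + 1" and j: "j = p + 1 + d" and n: "n = b + 1 + d" and p: "p \<le> b"
    by blast
  have t: "time n i j = triangle b + i"
    by (simp add: time_def i j n)
  obtain k where k: "time n i j = Suc k"
    using time_beta(1)[OF assms] by (cases "time n i j") auto
  then show "cell n (time n i j) (i + j - 1) = (i, j)"
    using time_beta[OF assms] by simp
  show "cell n (time n i j) (i + j - 2) = (i - 1, j)" if m: "2 \<le> i + j - 1"
  proof -
    have "zigzag n d (2 * p + d) = p"
      using p unfolding zigzag_def n by linarith
    then have "cell n (triangle b + i) (2 * p + d) = (p, 2 * p + d + 1 - p)"
      using p m by (intro cell_eq_zigzag) (simp_all add: i j n)
    moreover have "i + j - 2 = 2 * p + d" "i - 1 = p" "2 * p + d + 1 - p = j"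
      by (simp_all add: i j)
    ultimately show ?thesis
      by (simp only: t)
  qed
  show "cell n (time n i j) (i + j) = (i, j + 1)" if m: "i + j - 1 < 2 * n - 1"
  proof -
    have "zigzag n (d + 1) (2 * p + 2 + d) = p + 1"
      using p unfolding zigzag_def n by linarith
    then have "cell n (triangle b + i) (2 * p + 2 + d) = (p + 1, 2 * p + 2 + d + 1 - (p + 1))"
      using p m by (intro cell_eq_zigzag) (simp_all add: i j n)
    moreover have "i + j = 2 * p + 2 + d" "2 * p + 2 + d + 1 - (p + 1) = j + 1"
      by (simp_all add: i j)
    ultimately show ?thesis
      by (simp only: t[unfolded i] i)
  qed
qed

section \<open>Subspaces between \<open>F\<^bsub>j-1\<^esub>\<close> and \<open>F\<^bsub>n+i\<^esub>\<close>\<close>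

text \<open>The indices of the basis vectors that span \<open>V\<^bsub>i,j\<^esub>\<close>.\<close>

definition Vsub_indices :: "nat \<Rightarrow> nat \<Rightarrow> nat \<Rightarrow> nat set" where
  "Vsub_indices n i j = {1..<i} \<union> {j..n + 1}"

text \<open>The functions \<open>up\<close> and \<open>down\<close> are the mutually inverse renumberings of
  basis vectors that underlie \<open>V\<^bsub>i,j\<^esub> \<simeq> F\<^bsub>n+i\<^esub> /
  F\<^bsub>j-1\<^esub>\<close>: the index \<open>t < i\<close> corresponds to \<open>t + n + 1\<close>, and
  the indices from \<open>j\<close> to \<open>n + 1\<close> correspond to themselves.\<close>

definition up :: "nat \<Rightarrow> nat \<Rightarrow> nat \<Rightarrow> nat" where
  "up n i t = (if t < i then t + n + 1 else t)"

definition down :: "nat \<Rightarrow> nat \<Rightarrow> nat" where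
  "down n s = (if s \<le> n + 1 then s else s - n - 1)"

text \<open>For \<open>i \<ge> 1\<close> this is the quotient map \<open>F\<^bsub>n+i\<^esub> \<rightarrow>
  V\<^bsub>i,j\<^esub>\<close> with kernel \<open>F\<^bsub>j-1\<^esub>\<close>, which is
  \<open>\<pi>\<^sub>i\<close> for \<open>i = j\<close>. The map \<open>lift\<close> below is its linear
  section with values in the span of \<open>e\<^sub>j, \<dots>, e\<^bsub>n+i\<^esub>\<close>.\<close>

definition proj :: "nat \<Rightarrow> nat \<Rightarrow> nat \<Rightarrow> cvec \<Rightarrow> cvec" where
  "proj n i j w = (\<lambda>t. if t \<in> Vsub_indices n i j then w (up n i t) else 0)"

definition lift :: "nat \<Rightarrow> nat \<Rightarrow> nat \<Rightarrow> cvec \<Rightarrow> cvec" where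
  "lift n i j z = (\<lambda>s. if s \<in> {j..n + i} then z (down n s) else 0)"

definition preim :: "nat \<Rightarrow> nat \<Rightarrow> nat \<Rightarrow> cvec set \<Rightarrow> cvec set" where
  "preim n i j S = {w \<in> coord_space (n + i). proj n i j w \<in> S}"

text \<open>The image of \<open>U\<close> in \<open>V\<^bsub>i,j\<^esub>\<close> if
  \<open>F\<^bsub>j-1\<^esub> \<subseteq> U \<subseteq> F\<^bsub>n+i\<^esub>\<close>, written as a preimage
  under the section.\<close>

definition descend :: "nat \<Rightarrow> nat \<Rightarrow> nat \<Rightarrow> cvec set \<Rightarrow> cvec set" where
  "descend n i j U = {z \<in> Vsub n i j. lift n i j z \<in> U}"

lemma up_in_range: "(i, j) \<in> R_indices n \<Longrightarrow> t \<in> Vsub_indices n i j \<Longrightarrow> up n i t \<in> {j..n + i}"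
  by (auto simp: R_indices_def Vsub_indices_def up_def)

lemma down_in_Vsub_indices: "(i, j) \<in> R_indices n \<Longrightarrow> s \<in> {j..n + i} \<Longrightarrow> down n s \<in> Vsub_indices n i j"
  by (auto simp: R_indices_def Vsub_indices_def down_def)

lemma down_up: "(i, j) \<in> R_indices n \<Longrightarrow> t \<in> Vsub_indices n i j \<Longrightarrow> down n (up n i t) = t"
  by (auto simp: R_indices_def Vsub_indices_def up_def down_def)

lemma up_down: "(i, j) \<in> R_indices n \<Longrightarrow> s \<in> {j..n + i} \<Longrightarrow> up n i (down n s) = s"
  by (auto simp: R_indices_def up_def down_def)

lemma Vsub_eq:
  assumes "i \<le> j"
  shows "Vsub n i j = {v. \<forall>t. t \<notin> Vsub_indices n i j \<longrightarrow> v t = 0}"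
proof -
  define ks where "ks = [1..<i] @ [j..<n + 2]"
  have ks: "set ks = Vsub_indices n i j"
    by (auto simp: Vsub_indices_def ks_def)
  have "distinct ks"
    using assms by (auto simp: ks_def)
  then have "cvs.span (unit ` set ks) = {v. \<forall>t. t \<notin> set ks \<longrightarrow> v t = 0}"
    using frame_units by (simp add: frame_def)
  then show ?thesis
    by (simp only: ks Vsub_def) (simp only: Vsub_indices_def)
qed

lemma Vsub_subset_coord_space: "(i, j) \<in> R_indices n \<Longrightarrow> Vsub n i j \<subseteq> coord_space (n + 1)"
  by (auto simp: R_indices_def Vsub_eq coord_space_def Vsub_indices_def)

lemma proj_lift:
  assumes "(i, j) \<in> R_indices n" "z \<in> Vsub n i j"
  shows "proj n i j (lift n i j z) = z"
proof
  fix t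
  have "i \<le> j"
    using assms(1) by (simp add: R_indices_def)
  then show "proj n i j (lift n i j z) t = z t"
    using assms up_in_range[OF assms(1), of t] down_up[OF assms(1), of t]
    by (auto simp: proj_def lift_def Vsub_eq)
qed

lemma lift_proj:
  assumes "(i, j) \<in> R_indices n" "w \<in> coord_space (n + i)"
  shows "lift n i j (proj n i j w) = clear {1..<j} w"
proof
  fix s
  consider "s \<in> {j..n + i}" | "s = 0 \<or> n + i < s" "s \<notin> {j..n + i}" | "s \<in> {1..<j}"
    using assms(1) by (fastforce simp: R_indices_def)
  then show "lift n i j (proj n i j w) s = clear {1..<j} w s"
  proof cases
    case 1
    then show ?thesis
      using down_in_Vsub_indices[OF assms(1) 1] up_down[OF assms(1) 1]
      by (auto simp: lift_def proj_def clear_def)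
  next
    case 2
    then have "w s = 0"
      using assms(2) by (auto simp: coord_space_def)
    then show ?thesis
      using 2 by (auto simp: lift_def clear_def)
  next
    case 3
    then show ?thesis
      by (auto simp: lift_def clear_def)
  qed
qed

lemma lift_in_coord_space: "(i, j) \<in> R_indices n \<Longrightarrow> lift n i j z \<in> coord_space (n + i)"
  by (auto simp: lift_def coord_space_def R_indices_def)

lemma proj_in_Vsub: "i \<le> j \<Longrightarrow> proj n i j w \<in> Vsub n i j"
  by (auto simp: Vsub_eq proj_def)

lemma linear_lift: "Vector_Spaces.linear cscale cscale (lift n i j)"
  by unfold_locales (auto simp: lift_def cscale_def fun_eq_iff)

lemma descend_preim:
  assumes "(i, j) \<in> R_indices n" "S \<subseteq> Vsub n i j"
  shows "descend n i j (preim n i j S) = S"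
  using assms lift_in_coord_space[OF assms(1)] proj_lift[OF assms(1)]
  by (auto simp: descend_def preim_def)

text \<open>A vector of \<open>F\<^bsub>n+i\<^esub>\<close> differs from the lift of its projection by an
  element of \<open>F\<^bsub>j-1\<^esub>\<close>, hence of \<open>U\<close>.\<close>

lemma preim_descend:
  assumes "(i, j) \<in> R_indices n" "cvs.subspace U" "coord_space (j - 1) \<subseteq> U" "U \<subseteq> coord_space (n + i)"
  shows "preim n i j (descend n i j U) = U"
proof -
  have ij: "i \<le> j"
    using assms(1) by (simp add: R_indices_def)
  have "clear {1..<j} w \<in> U \<longleftrightarrow> w \<in> U" if "w \<in> coord_space (n + i)" for w
  proof -
    have "w - clear {1..<j} w \<in> coord_space (j - 1)"
      using that by (auto simp: coord_space_def clear_def)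
    then have d: "w - clear {1..<j} w \<in> U"
      using assms(3) by blast
    show ?thesis
    proof
      assume "clear {1..<j} w \<in> U"
      then show "w \<in> U"
        using cvs.subspace_add[OF assms(2) d, of "clear {1..<j} w"] by simp
    next
      assume "w \<in> U"
      then show "clear {1..<j} w \<in> U"
        using cvs.subspace_diff[OF assms(2) _ d, of w] by simp
    qed
  qed
  then show ?thesis
    using assms(4) proj_in_Vsub[OF ij] by (auto simp: preim_def descend_def lift_proj[OF assms(1)])
qed

lemma preim_eq_clear:
  assumes "(i, j) \<in> R_indices n" "S \<subseteq> Vsub n i j"
  shows "preim n i j S = {w. clear {1..<j} w \<in> lift n i j ` S}"
proof (rule Set.set_eqI, rule iffI)
  fix w assume "w \<in> preim n i j S"
  then have "w \<in> coord_space (n + i)" "proj n i j w \<in> S"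
    by (auto simp: preim_def)
  then show "w \<in> {w. clear {1..<j} w \<in> lift n i j ` S}"
    using lift_proj[OF assms(1)] by (metis imageI mem_Collect_eq)
next
  fix w assume "w \<in> {w. clear {1..<j} w \<in> lift n i j ` S}"
  then obtain z where z: "z \<in> S" "clear {1..<j} w = lift n i j z"
    by blast
  have "w s = 0" if "s \<notin> {1..n + i}" for s
  proof -
    have "s \<notin> {1..<j}" "s \<notin> {j..n + i}"
      using that assms(1) by (auto simp: R_indices_def)
    then show ?thesis
      using fun_cong[OF z(2), of s] by (simp only: clear_def lift_def if_False)
  qed
  moreover have "proj n i j w = proj n i j (clear {1..<j} w)"
    using up_in_range[OF assms(1)] by (force simp: proj_def clear_def)
  ultimately show "w \<in> preim n i j S"
    using z assms(2) proj_lift[OF assms(1), of z] by (auto simp: preim_def coord_space_def)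
qed

lemma frame_image:
  assumes "Vector_Spaces.linear cscale cscale f" "frame S b" "inj_on f S"
  shows "frame (f ` S) (map f b)"
proof -
  interpret f: Vector_Spaces.linear cscale cscale f
    by (fact assms(1))
  have b: "distinct b" "cvs.independent (set b)" "cvs.span (set b) = S"
    using assms(2) by (auto simp: frame_def)
  then have "inj_on f (set b)"
    using assms(3) cvs.span_superset[of "set b"] by (metis inj_on_subset)
  then show ?thesis
    using b(1) assms(3) f.independent_injective_image[OF b(2)] f.span_image[of "set b"]
    by (simp add: frame_def distinct_map b(3))
qed

text \<open>A basis of the preimage is \<open>e\<^sub>1, \<dots>, e\<^bsub>j-1\<^esub>\<close> followed by the
  lifts of a basis of \<open>S\<close>; the first part spans the kernel. On this basis rests the comparison of
  Pluecker coordinates.\<close>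

lemma frame_preim:
  assumes "(i, j) \<in> R_indices n" "frame S b" "S \<subseteq> Vsub n i j"
  shows "frame (preim n i j S) (map unit [1..<j] @ map (lift n i j) b)"
proof -
  have "inj_on (lift n i j) S"
    by (rule inj_on_inverseI[of S "proj n i j"]) (use proj_lift[OF assms(1)] assms(3) in blast)
  then have "frame (lift n i j ` S) (map (lift n i j) b)"
    using frame_image[OF linear_lift assms(2)] by blast
  then have "frame {w. clear (set [1..<j]) w \<in> lift n i j ` S} (map unit [1..<j] @ map (lift n i j) b)"
    by (intro frame_prepend_units) (auto simp: lift_def)
  then show ?thesis
    using preim_eq_clear[OF assms(1,3)] by simp
qed

lemma plucker_lift:
  assumes "length r = length b"
  shows "plucker (map (lift n i j) b) r = (if set r \<subseteq> {j..n + i} then plucker b (map (down n) r) else 0)"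
proof (cases "set r \<subseteq> {j..n + i}")
  case True
  then have "r ! s \<in> {j..n + i}" if "s < length r" for s
    using that nth_mem by blast
  then show ?thesis
    using True assms by (auto simp: lift_def intro!: plucker_cong)
next
  case False
  then obtain k where "k \<in> set r" "k \<notin> {j..n + i}"
    by blast
  then have "plucker (map (lift n i j) b) r = 0"
    using assms by (intro plucker_zero_row[of k]) (auto simp: lift_def)
  then show ?thesis
    using False by (simp only: if_False)
qed

lemma plucker_frame_preim:
  assumes "(i, j) \<in> R_indices n" "length r = length b" "set r \<subseteq> Vsub_indices n i j"
  shows "plucker (map unit [1..<j] @ map (lift n i j) b) ([1..<j] @ map (up n i) r) = plucker b r"
proof -
  have up: "up n i t \<in> {j..n + i}" if "t \<in> set r" for t
    using that assms up_in_range[OF assms(1)] by blast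
  then have "set [1..<j] \<inter> set (map (up n i) r) = {}"
    by force
  then have "plucker (map unit [1..<j] @ map (lift n i j) b) ([1..<j] @ map (up n i) r)
      = plucker (map (lift n i j) b) (map (up n i) r)"
    using assms(2) by (intro plucker_units_append) auto
  also have "\<dots> = plucker b (map (down n) (map (up n i) r))"
    using up assms(2) by (subst plucker_lift) auto
  also have "map (down n) (map (up n i) r) = r"
    using assms(3) down_up[OF assms(1)] by (auto simp: subset_iff intro!: map_idI)
  finally show ?thesis .
qed

text \<open>On \<open>F\<^bsub>n+i\<^esub>\<close> the projection for \<open>i + 1\<close> agrees with the one
  for \<open>i\<close>, since only \<open>e\<^bsub>n+i+1\<^esub>\<close> is mapped to the new basis vector
  \<open>f\<^sub>i\<close>.\<close>

lemma preim_mono_row: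
  assumes "(i + 1, j) \<in> R_indices n \<or> j = n + 1 \<and> i < n" "S \<subseteq> T"
  shows "preim n i j S \<subseteq> preim n (i + 1) j T"
proof
  fix w assume w: "w \<in> preim n i j S"
  then have w0: "w \<in> coord_space (n + i)"
    by (simp add: preim_def)
  have "w (i + n + 1) = 0"
    using w0 by (simp add: coord_space_def)
  have ij: "i < j"
    using assms(1) by (auto simp: R_indices_def)
  have "proj n (i + 1) j w = proj n i j w"
  proof
    fix t
    have "t = i \<Longrightarrow> up n (i + 1) t = i + n + 1" "t \<noteq> i \<Longrightarrow> up n (i + 1) t = up n i t"
      "t \<noteq> i \<Longrightarrow> t \<in> Vsub_indices n (i + 1) j \<longleftrightarrow> t \<in> Vsub_indices n i j" "i \<notin> Vsub_indices n i j"
      using ij by (auto simp: up_def Vsub_indices_def)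
    then show "proj n (i + 1) j w t = proj n i j w t"
      using \<open>w (i + n + 1) = 0\<close> by (cases "t = i") (simp_all add: proj_def)
  qed
  then show "w \<in> preim n (i + 1) j T"
    using w w0 assms(2) by (auto simp: preim_def coord_space_def)
qed

text \<open>The projection for \<open>j + 1\<close> is the one for \<open>j\<close> followed by \<open>pr
  j\<close>; as \<open>i \<le> j\<close>, erasing the coordinate \<open>j\<close> does not affect the indices
  below \<open>i\<close>.\<close>

lemma preim_mono_column:
  assumes "i \<le> j" "pr j ` S \<subseteq> T"
  shows "preim n i j S \<subseteq> preim n i (j + 1) T"
proof -
  have "proj n i (j + 1) w = pr j (proj n i j w)" for w
    using assms(1) by (auto simp: proj_def pr_def Vsub_indices_def)
  then show ?thesis
    using assms(2) by (auto simp: preim_def)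
qed

lemma preim_zero:
  assumes "1 \<le> j" "j \<le> n + 1"
  shows "preim n 0 j {0} = coord_space (j - 1)"
proof -
  have "proj n 0 j w = 0 \<longleftrightarrow> (\<forall>t\<in>{j..n + 1}. w t = 0)" for w
    by (auto simp: proj_def Vsub_indices_def up_def fun_eq_iff)
  then have "preim n 0 j {0} = {w. (\<forall>s. s \<notin> {1..n} \<longrightarrow> w s = 0) \<and> (\<forall>t\<in>{j..n + 1}. w t = 0)}"
    by (simp add: preim_def coord_space_def)
  also have "\<dots> = {w. \<forall>s. s \<notin> {1..j - 1} \<longrightarrow> w s = 0}"
  proof -
    have "s \<notin> {1..j - 1} \<longleftrightarrow> s \<notin> {1..n} \<or> s \<in> {j..n + 1}" for s
      using assms by auto
    then show ?thesis
      by blast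
  qed
  finally show ?thesis
    by (simp add: coord_space_def)
qed

lemma preim_full:
  assumes "i \<le> n"
  shows "preim n i (n + 1) (coord_space (n + 1)) = coord_space (n + i)"
  using assms by (auto simp: preim_def proj_def Vsub_indices_def coord_space_def)

section \<open>Mutually inverse bijections\<close>

text \<open>The pairs to which the conventions \<open>Z\<^bsub>0,k\<^esub> = {0}\<close> and
  \<open>Z\<^bsub>k,n+1\<^esub> = V\<close> apply.\<close>

definition boundary :: "nat \<Rightarrow> nat \<Rightarrow> nat \<Rightarrow> bool" where
  "boundary n i j \<longleftrightarrow> i = 0 \<or> j = n + 1"

definition psi :: "nat \<Rightarrow> (nat \<times> nat \<Rightarrow> cvec set) \<Rightarrow> nat \<times> nat \<Rightarrow> cvec set" where
  "psi n Z = (\<lambda>(k, m)\<in>{0..N_of n} \<times> {1..2 * n - 1}.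
     case cell n k m of (i, j) \<Rightarrow> preim n i j (Zext n Z i j))"

definition chi :: "nat \<Rightarrow> (nat \<times> nat \<Rightarrow> cvec set) \<Rightarrow> nat \<times> nat \<Rightarrow> cvec set" where
  "chi n U = (\<lambda>(i, j)\<in>R_indices n. descend n i j (U (time n i j, i + j - 1)))"

lemma cell_boundary_or_index:
  assumes "k \<le> N_of n" "m \<in> {1..2 * n - 1}" "cell n k m = (i, j)"
  shows "boundary n i j \<or> (i, j) \<in> R_indices n"
  using cell_bounds[OF assms] by (auto simp: boundary_def R_indices_def)

text \<open>With the conventions for \<open>Z\<close>, the boundary pairs yield members of the standard
  flag.\<close>

lemma preim_Zext_boundary:
  assumes "boundary n i j" "1 \<le> j" "j \<le> n + 1" "i \<le> n"
  shows "preim n i j (Zext n Z i j) = coord_space (i + j - 1)"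
proof (cases "i = 0")
  case True
  then show ?thesis
    using preim_zero assms by (simp add: Zext_def)
next
  case False
  then have "j = n + 1"
    using assms(1) by (simp add: boundary_def)
  then show ?thesis
    using False preim_full[OF assms(4)] by (simp add: Zext_def add.commute)
qed

lemma points_R_iff:
  "Z \<in> points (R n) \<longleftrightarrow> Z \<in> extensional (R_indices n) \<and>
    (\<forall>i j. (i, j) \<in> R_indices n \<longrightarrow> Z (i, j) \<in> Gr i (Vsub n i j)) \<and>
    (\<forall>i j. (i, j) \<in> R_indices n \<longrightarrow> Zext n Z (i - 1) j \<subseteq> Zext n Z i j) \<and>
    (\<forall>i j. (i, j) \<in> R_indices n \<longrightarrow> pr j ` Zext n Z i j \<subseteq> Zext n Z i (j + 1))"
  unfolding R_def PiE_def Pi_def by (simp add: Ball_def) blast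

lemma
  assumes "Z \<in> points (R n)" "(i, j) \<in> R_indices n"
  shows R_Gr: "Z (i, j) \<in> Gr i (Vsub n i j)"
    and R_row: "Zext n Z (i - 1) j \<subseteq> Zext n Z i j"
    and R_column: "pr j ` Zext n Z i j \<subseteq> Zext n Z i (j + 1)"
  using assms unfolding points_R_iff by blast+

lemma points_BS_iff:
  "U \<in> points (BS n) \<longleftrightarrow> U \<in> extensional ({0..N_of n} \<times> {1..2 * n - 1}) \<and>
    (\<forall>k m. k \<le> N_of n \<longrightarrow> m \<in> {1..2 * n - 1} \<longrightarrow> U (k, m) \<in> Gr m (coord_space (2 * n))) \<and>
    (\<forall>k m. k \<le> N_of n \<longrightarrow> 1 \<le> m \<longrightarrow> m < 2 * n - 1 \<longrightarrow> U (k, m) \<subseteq> U (k, m + 1)) \<and>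
    (\<forall>m. m \<in> {1..2 * n - 1} \<longrightarrow> U (0, m) = coord_space m) \<and>
    (\<forall>k m. k < N_of n \<longrightarrow> m \<in> {1..2 * n - 1} \<longrightarrow> m \<noteq> ell n (k + 1) \<longrightarrow> U (k + 1, m) = U (k, m))"
  unfolding BS_def PiE_def Pi_def by (simp add: Ball_def) blast

lemma Zext_index: "(i, j) \<in> R_indices n \<Longrightarrow> Zext n Z i j = Z (i, j)"
  by (simp add: Zext_def R_indices_def)

lemma psi_at:
  assumes "k \<le> N_of n" "m \<in> {1..2 * n - 1}" "cell n k m = (i, j)"
  shows "psi n Z (k, m) = preim n i j (Zext n Z i j)"
  using assms by (simp add: psi_def)

lemma psi_boundary:
  assumes "k \<le> N_of n" "m \<in> {1..2 * n - 1}" "cell n k m = (i, j)" "boundary n i j"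
  shows "psi n Z (k, m) = coord_space m"
  using cell_bounds[OF assms(1-3)] preim_Zext_boundary[OF assms(4)] psi_at[OF assms(1-3)] by simp

lemma psi_frame:
  assumes "Z \<in> points (R n)" "\<And>v. v \<in> R_indices n \<Longrightarrow> frame (Z v) (b v)"
    and "k \<le> N_of n" "m \<in> {1..2 * n - 1}" "cell n k m = (i, j)"
  shows "frame (psi n Z (k, m))
    (if boundary n i j then map unit [1..<Suc m] else map unit [1..<j] @ map (lift n i j) (b (i, j)))"
proof (cases "boundary n i j")
  case True
  then show ?thesis
    using psi_boundary[OF assms(3-5)] frame_coord_space by (simp del: upt_Suc)
next
  case False
  then have ij: "(i, j) \<in> R_indices n"
    using cell_boundary_or_index[OF assms(3-5)] by blast
  then have "Z (i, j) \<subseteq> Vsub n i j"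
    using R_Gr[OF assms(1)] by (simp add: Gr_def)
  then show ?thesis
    using False frame_preim[OF ij assms(2)[OF ij]] by (simp add: psi_at[OF assms(3-5)] Zext_index[OF ij])
qed

lemma R_frames:
  assumes "Z \<in> points (R n)" "(i, j) \<in> R_indices n"
  obtains b where "frame (Z (i, j)) b" "length b = i"
proof -
  have Z: "Z (i, j) \<in> Gr i (Vsub n i j)"
    by (rule R_Gr[OF assms])
  then obtain b where b: "frame (Z (i, j)) b"
    using obtain_frame[of "Z (i, j)" "n + 1"] Vsub_subset_coord_space[OF assms(2)]
    by (auto simp: Gr_def)
  then show ?thesis
    using that Z by (auto simp: Gr_def frame_length)
qed

text \<open>Two consecutive positions of a flag carry pairs that differ by a unit step, so their inclusion is
  one of the inclusions between the \<open>Z\<^bsub>i,j\<^esub>\<close>. Steps change one position because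
  only one cell changes.\<close>

lemma psi_in_BS:
  assumes Z: "Z \<in> points (R n)"
  shows "psi n Z \<in> points (BS n)"
proof -
  have "\<forall>v\<in>R_indices n. \<exists>b. frame (Z v) b \<and> length b = fst v"
    using R_frames[OF Z] by (metis fst_conv surj_pair)
  then obtain b where b: "\<And>v. v \<in> R_indices n \<Longrightarrow> frame (Z v) (b v)"
      "\<And>v. v \<in> R_indices n \<Longrightarrow> length (b v) = fst v"
    by (metis bchoice)
  have Gr: "psi n Z (k, m) \<in> Gr m (coord_space (2 * n))" if km: "k \<le> N_of n" "m \<in> {1..2 * n - 1}" for k m
  proof -
    obtain i j where c: "cell n k m = (i, j)"
      by fastforce
    note bounds = cell_bounds[OF km c]
    have "coord_space (n + i) \<subseteq> coord_space (2 * n)" "coord_space m \<subseteq> coord_space (2 * n)"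
      using bounds km by (auto simp: coord_space_def)
    then have "psi n Z (k, m) \<subseteq> coord_space (2 * n)"
      using psi_boundary[OF km c] psi_at[OF km c] by (cases "boundary n i j") (auto simp: preim_def)
    moreover have "length (b (i, j)) = i" if "\<not> boundary n i j"
      using cell_boundary_or_index[OF km c] b(2) that by fastforce
    ultimately show ?thesis
      using psi_frame[OF Z b(1) km c] bounds by (intro frame_in_Gr) (auto simp del: upt_Suc)
  qed
  have flag: "psi n Z (k, m) \<subseteq> psi n Z (k, m + 1)" if km: "k \<le> N_of n" "1 \<le> m" "m < 2 * n - 1" for k m
  proof -
    have m: "m \<in> {1..2 * n - 1}" "m + 1 \<in> {1..2 * n - 1}"
      using km by auto
    obtain i j where c: "cell n k m = (i, j)"
      by fastforce
    note bounds = cell_bounds[OF km(1) m(1) c]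
    show ?thesis
    proof (cases "cell n k (m + 1) = (i + 1, j)")
      case True
      note bounds' = cell_bounds[OF km(1) m(2) True]
      have idx: "(i + 1, j) \<in> R_indices n \<or> j = n + 1 \<and> i < n"
        using cell_boundary_or_index[OF km(1) m(2) True] bounds' by (auto simp: boundary_def)
      have "Zext n Z i j \<subseteq> Zext n Z (i + 1) j"
      proof (cases "j = n + 1")
        case True
        then show ?thesis
          by (auto simp: Zext_def coord_space_def)
      next
        case False
        then have "(i + 1, j) \<in> R_indices n"
          using idx by blast
        then show ?thesis
          using R_row[OF Z, of "i + 1" j] by simp
      qed
      then show ?thesis
        unfolding psi_at[OF km(1) m(1) c] psi_at[OF km(1) m(2) True] by (rule preim_mono_row[OF idx])
    next
      case False
      then have c': "cell n k (m + 1) = (i, j + 1)"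
        using cell_adjacent[OF km c] by blast
      note bounds' = cell_bounds[OF km(1) m(2) c']
      have "pr j ` Zext n Z i j \<subseteq> Zext n Z i (j + 1)"
      proof (cases "i = 0")
        case True
        then show ?thesis
          by (auto simp: Zext_def pr_def)
      next
        case False
        then have "(i, j) \<in> R_indices n"
          using bounds bounds' by (auto simp: R_indices_def)
        then show ?thesis
          by (rule R_column[OF Z])
      qed
      then show ?thesis
        unfolding psi_at[OF km(1) m(1) c] psi_at[OF km(1) m(2) c'] by (rule preim_mono_column[OF bounds(2)])
    qed
  qed
  have start: "psi n Z (0, m) = coord_space m" if "m \<in> {1..2 * n - 1}" for m
    using that by (intro psi_boundary[OF _ _ cell.simps(1)]) (auto simp: boundary_def)
  have step: "psi n Z (k + 1, m) = psi n Z (k, m)"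
    if "k < N_of n" "m \<in> {1..2 * n - 1}" "m \<noteq> ell n (k + 1)" for k m
    using that by (simp add: psi_def)
  have "psi n Z \<in> extensional ({0..N_of n} \<times> {1..2 * n - 1})"
    by (simp add: psi_def)
  then show ?thesis
    using Gr flag start step unfolding points_BS_iff by blast
qed

text \<open>The subspace that a point of \<open>BS n\<close> attaches to the pair \<open>(i, j)\<close>, read
  off when this pair is treated.\<close>

definition at_cell :: "nat \<Rightarrow> (nat \<times> nat \<Rightarrow> cvec set) \<Rightarrow> nat \<Rightarrow> nat \<Rightarrow> cvec set" where
  "at_cell n U i j = (if boundary n i j then coord_space (i + j - 1) else U (time n i j, i + j - 1))"

text \<open>A position keeps its subspace until the next step at this position, and that is also how the pair
  occupying it evolves.\<close>

lemma BS_at_cell: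
  assumes U: "U \<in> points (BS n)" and "k \<le> N_of n" "m \<in> {1..2 * n - 1}" "cell n k m = (i, j)"
  shows "U (k, m) = at_cell n U i j"
  using assms(2-4)
proof (induction k arbitrary: i j)
  case 0
  then have "boundary n i j" "i + j - 1 = m"
    by (auto simp: boundary_def)
  then show ?case
    using U 0 by (simp add: points_BS_iff at_cell_def)
next
  case (Suc k)
  show ?case
  proof (cases "m = ell n (Suc k)")
    case True
    then have "beta n (Suc k) = (i, j)"
      using Suc.prems by simp
    then have "(i, j) \<in> R_indices n" "time n i j = Suc k"
      using beta_time[of "Suc k" n i j] Suc.prems by auto
    then show ?thesis
      using cell_bounds(1)[OF Suc.prems] by (auto simp: at_cell_def boundary_def R_indices_def)
  next
    case False
    then have "U (Suc k, m) = U (k, m)"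
      using U Suc.prems by (auto simp: points_BS_iff)
    then show ?thesis
      using False Suc by simp
  qed
qed

lemma index_position: "(i, j) \<in> R_indices n \<Longrightarrow> i + j - 1 \<in> {1..2 * n - 1}"
  by (auto simp: R_indices_def)

lemma at_cell_index: "(i, j) \<in> R_indices n \<Longrightarrow> at_cell n U i j = U (time n i j, i + j - 1)"
  by (auto simp: at_cell_def boundary_def R_indices_def)

lemma at_cell_in_Gr:
  assumes "U \<in> points (BS n)" "(i, j) \<in> R_indices n"
  shows "at_cell n U i j \<in> Gr (i + j - 1) (coord_space (2 * n))"
  using assms time_beta(1)[OF assms(2)] index_position[OF assms(2)]
  by (simp add: points_BS_iff at_cell_index)

text \<open>The two neighbours of \<open>(i, j)\<close> at the time of its treatment are members of the same
  flag. At the two ends of the flag a neighbour is missing; there the claim is \<open>{0} \<subseteq>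
  U\<close> or \<open>U \<subseteq> W\<close>.\<close>

lemma at_cell_mono:
  assumes U: "U \<in> points (BS n)" and ij: "(i, j) \<in> R_indices n"
  shows "at_cell n U (i - 1) j \<subseteq> at_cell n U i j" "at_cell n U i j \<subseteq> at_cell n U i (j + 1)"
proof -
  let ?k = "time n i j" and ?m = "i + j - 1"
  have k: "?k \<le> N_of n"
    using time_beta(1)[OF ij] by simp
  have ij': "1 \<le> i" "i \<le> j" "j \<le> n"
    using ij by (auto simp: R_indices_def)
  have m: "?m \<in> {1..2 * n - 1}"
    by (rule index_position[OF ij])
  note here = BS_at_cell[OF U k m cell_at_time(1)[OF ij]]
  have flag: "U (?k, m) \<subseteq> U (?k, m + 1)" if "1 \<le> m" "m < 2 * n - 1" for m
    using U k that by (simp add: points_BS_iff)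
  show "at_cell n U (i - 1) j \<subseteq> at_cell n U i j"
  proof (cases "2 \<le> ?m")
    case True
    then have m': "i + j - 2 \<in> {1..2 * n - 1}" and s: "i + j - 2 + 1 = ?m"
      using m by auto
    show ?thesis
      using flag[of "i + j - 2"] BS_at_cell[OF U k m' cell_at_time(2)[OF ij True]] here m m' s by simp
  next
    case False
    then have "i = 1" "j = 1"
      using ij' by auto
    then have "at_cell n U (i - 1) j = {0}"
      by (auto simp: at_cell_def boundary_def coord_space_def)
    then show ?thesis
      using at_cell_in_Gr[OF U ij] by (auto simp: Gr_def cvs.subspace_0)
  qed
  show "at_cell n U i j \<subseteq> at_cell n U i (j + 1)"
  proof (cases "?m < 2 * n - 1")
    case True
    then have m': "i + j \<in> {1..2 * n - 1}" and s: "?m + 1 = i + j"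
      using ij' by auto
    show ?thesis
      using flag[of ?m] BS_at_cell[OF U k m' cell_at_time(3)[OF ij True]] here m True s by simp
  next
    case False
    then have "i = n" "j = n"
      using ij' by auto
    then have "at_cell n U i (j + 1) = coord_space (2 * n)"
      by (simp add: at_cell_def boundary_def mult_2)
    then show ?thesis
      using at_cell_in_Gr[OF U ij] by (auto simp: Gr_def)
  qed
qed

text \<open>Descend along \<open>i\<close> to the boundary pair \<open>(0, j)\<close>.\<close>

lemma at_cell_lower:
  assumes U: "U \<in> points (BS n)" "(i, j) \<in> R_indices n"
  shows "coord_space (j - 1) \<subseteq> at_cell n U i j"
proof -
  have "i' \<le> i \<Longrightarrow> coord_space (j - 1) \<subseteq> at_cell n U i' j" for i'
  proof (induction i')
    case 0
    then show ?case by (simp add: at_cell_def boundary_def)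
  next
    case (Suc i')
    then have "(Suc i', j) \<in> R_indices n"
      using assms(2) by (auto simp: R_indices_def)
    then show ?case
      using Suc at_cell_mono(1)[OF U(1), of "Suc i'" j] by auto
  qed
  then show ?thesis by blast
qed

text \<open>Ascend along \<open>j\<close> to the boundary pair \<open>(i, n + 1)\<close>.\<close>

lemma at_cell_upper:
  assumes U: "U \<in> points (BS n)" "(i, j) \<in> R_indices n"
  shows "at_cell n U i j \<subseteq> coord_space (n + i)"
proof -
  have "j \<le> n + 1"
    using assms(2) by (auto simp: R_indices_def)
  then have "at_cell n U i j \<subseteq> at_cell n U i (n + 1)"
  proof (rule inc_induct)
    fix j' assume "j \<le> j'" "j' < n + 1" and IH: "at_cell n U i (Suc j') \<subseteq> at_cell n U i (n + 1)"
    then have "(i, j') \<in> R_indices n"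
      using assms(2) by (auto simp: R_indices_def)
    then show "at_cell n U i j' \<subseteq> at_cell n U i (n + 1)"
      using at_cell_mono(2)[OF U(1), of i j'] IH by auto
  qed simp
  then show ?thesis
    by (simp add: at_cell_def boundary_def add.commute)
qed

lemma chi_at: "(i, j) \<in> R_indices n \<Longrightarrow> chi n U (i, j) = descend n i j (at_cell n U i j)"
  by (simp add: chi_def at_cell_index)

lemma preim_chi:
  assumes "U \<in> points (BS n)" "(i, j) \<in> R_indices n"
  shows "preim n i j (chi n U (i, j)) = at_cell n U i j"
  using assms at_cell_lower[OF assms] at_cell_upper[OF assms] at_cell_in_Gr[OF assms]
  by (simp add: chi_at preim_descend Gr_def)

lemma chi_subset_Vsub: "(i, j) \<in> R_indices n \<Longrightarrow> chi n U (i, j) \<subseteq> Vsub n i j"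
  by (auto simp: chi_at descend_def)

text \<open>The dimension is found by counting: a frame of length \<open>d\<close> extends to a frame of
  length \<open>j - 1 + d\<close> of a space of dimension \<open>i + j - 1\<close>.\<close>

lemma chi_frame:
  assumes U: "U \<in> points (BS n)" and ij: "(i, j) \<in> R_indices n"
  obtains b where "frame (chi n U (i, j)) b" "length b = i"
proof -
  interpret lift: Vector_Spaces.linear cscale cscale "lift n i j"
    by (rule linear_lift)
  have "cvs.subspace (at_cell n U i j)"
    using at_cell_in_Gr[OF assms] by (simp add: Gr_def)
  then have "cvs.subspace {z. lift n i j z \<in> at_cell n U i j}"
    by (rule lift.subspace_linear_preimage)
  moreover have "cvs.subspace (Vsub n i j)"
    by (simp add: Vsub_def)
  moreover have "chi n U (i, j) = Vsub n i j \<inter> {z. lift n i j z \<in> at_cell n U i j}"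
    by (auto simp: chi_at[OF ij] descend_def)
  ultimately have "cvs.subspace (chi n U (i, j))"
    by (simp add: cvs.subspace_inter)
  then obtain b where b: "frame (chi n U (i, j)) b"
    using obtain_frame chi_subset_Vsub[OF ij] Vsub_subset_coord_space[OF ij] by (metis subset_trans)
  have "frame (at_cell n U i j) (map unit [1..<j] @ map (lift n i j) b)"
    using frame_preim[OF ij b chi_subset_Vsub[OF ij]] by (simp add: preim_chi[OF assms])
  then have "j - 1 + length b = i + j - 1"
    using frame_length at_cell_in_Gr[OF assms] by (fastforce simp: Gr_def)
  then have "length b = i"
    using ij by (auto simp: R_indices_def)
  then show ?thesis
    using that b by blast
qed

text \<open>The two inclusions between the \<open>U\<^bsub>i,j\<^esub>\<close> descend. For the second,
  lifting \<open>pr j z\<close> instead of \<open>z\<close> removes a multiple of \<open>e\<^sub>j\<close>,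
  which lies in \<open>F\<^sub>j \<subseteq> U\<^bsub>i,j+1\<^esub>\<close>.\<close>

lemma chi_in_R:
  assumes U: "U \<in> points (BS n)"
  shows "chi n U \<in> points (R n)"
proof -
  have Gr: "chi n U (i, j) \<in> Gr i (Vsub n i j)" if ij: "(i, j) \<in> R_indices n" for i j
    using chi_frame[OF U ij] frame_in_Gr chi_subset_Vsub[OF ij] by metis
  have row: "Zext n (chi n U) (i - 1) j \<subseteq> Zext n (chi n U) i j" if ij: "(i, j) \<in> R_indices n" for i j
  proof (cases "i = 1")
    case True
    then have "Zext n (chi n U) (i - 1) j = {0}"
      by (simp add: Zext_def)
    moreover have "0 \<in> chi n U (i, j)"
      using Gr[OF ij] by (simp add: Gr_def cvs.subspace_0)
    ultimately show ?thesis
      by (simp add: Zext_index[OF ij])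
  next
    case False
    then have ij': "(i - 1, j) \<in> R_indices n" and i: "i - 1 < i" "i \<le> j"
      using ij by (auto simp: R_indices_def)
    have "z \<in> chi n U (i, j)" if "z \<in> chi n U (i - 1, j)" for z
    proof -
      have z: "z \<in> Vsub n (i - 1) j" "lift n (i - 1) j z \<in> at_cell n U (i - 1) j"
        using that unfolding chi_at[OF ij'] descend_def by blast+
      have "z (i - 1) = 0"
        using z(1) i by (auto simp: Vsub_eq Vsub_indices_def)
      have "lift n i j z s = lift n (i - 1) j z s" for s
      proof (cases "s = n + i")
        case True
        then have "down n s = i - 1"
          using i False by (auto simp: down_def)
        then show ?thesis
          using True \<open>z (i - 1) = 0\<close> i by (simp add: lift_def)
      next
        case False
        then have "s \<in> {j..n + i} \<longleftrightarrow> s \<in> {j..n + (i - 1)}"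
          using i by auto
        then show ?thesis
          by (simp add: lift_def)
      qed
      then have "lift n i j z = lift n (i - 1) j z"
        by blast
      moreover have "z \<in> Vsub n i j"
        using z(1) i by (auto simp: Vsub_eq Vsub_indices_def)
      ultimately show ?thesis
        using z(2) at_cell_mono(1)[OF U ij] by (auto simp: chi_at[OF ij] descend_def)
    qed
    then show ?thesis
      unfolding Zext_index[OF ij] Zext_index[OF ij'] by blast
  qed
  have column: "pr j ` Zext n (chi n U) i j \<subseteq> Zext n (chi n U) i (j + 1)"
    if ij: "(i, j) \<in> R_indices n" for i j
  proof (cases "j = n")
    case True
    have "chi n U (i, j) \<subseteq> coord_space (n + 1)"
      using chi_subset_Vsub[OF ij] Vsub_subset_coord_space[OF ij] by blast
    moreover have "Zext n (chi n U) i (j + 1) = coord_space (n + 1)"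
      using True ij by (auto simp: Zext_def R_indices_def)
    ultimately show ?thesis
      by (auto simp: Zext_index[OF ij] pr_def coord_space_def)
  next
    case False
    then have ij': "(i, j + 1) \<in> R_indices n" and i: "1 \<le> i" "i \<le> j" "j \<le> n"
      using ij by (auto simp: R_indices_def)
    have "pr j z \<in> chi n U (i, j + 1)" if "z \<in> chi n U (i, j)" for z
    proof -
      have z: "z \<in> Vsub n i j" "lift n i j z \<in> at_cell n U i j"
        using that by (auto simp: chi_at[OF ij] descend_def)
      have eq: "lift n i (j + 1) (pr j z) = lift n i j z - cscale (z j) (unit j)"
      proof
        fix s
        have "down n j = j" "s \<in> {j + 1..n + i} \<Longrightarrow> down n s \<noteq> j"
          using i by (auto simp: down_def)
        then show "lift n i (j + 1) (pr j z) s = (lift n i j z - cscale (z j) (unit j)) s"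
          using i by (cases "s = j") (auto simp: lift_def pr_def cscale_def unit_def)
      qed
      have "unit j \<in> at_cell n U i (j + 1)"
        using at_cell_lower[OF U ij'] i by (auto simp: coord_space_def unit_def)
      moreover have "cvs.subspace (at_cell n U i (j + 1))"
        using at_cell_in_Gr[OF U ij'] by (simp add: Gr_def)
      moreover have "lift n i j z \<in> at_cell n U i (j + 1)"
        using z(2) at_cell_mono(2)[OF U ij] by blast
      ultimately have "lift n i (j + 1) (pr j z) \<in> at_cell n U i (j + 1)"
        unfolding eq by (intro cvs.subspace_diff cvs.subspace_scale)
      moreover have "pr j z \<in> Vsub n i (j + 1)"
        using z(1) i by (auto simp: Vsub_eq Vsub_indices_def pr_def)
      ultimately show ?thesis
        unfolding chi_at[OF ij'] descend_def by blast
    qed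
    then show ?thesis
      unfolding Zext_index[OF ij] Zext_index[OF ij'] by blast
  qed
  have "chi n U \<in> extensional (R_indices n)"
    by (simp add: chi_def)
  then show ?thesis
    using Gr row column unfolding points_R_iff by blast
qed

lemma chi_psi:
  assumes "Z \<in> points (R n)"
  shows "chi n (psi n Z) = Z"
proof (rule extensionalityI[of _ "R_indices n"])
  show "chi n (psi n Z) \<in> extensional (R_indices n)" "Z \<in> extensional (R_indices n)"
    using assms by (simp_all add: chi_def points_R_iff)
  fix v assume "v \<in> R_indices n"
  then obtain i j where v: "v = (i, j)" and ij: "(i, j) \<in> R_indices n"
    by (cases v) auto
  have "psi n Z (time n i j, i + j - 1) = preim n i j (Z (i, j))"
    using psi_at[OF _ index_position[OF ij] cell_at_time(1)[OF ij]] time_beta(1)[OF ij]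
    by (simp add: Zext_index[OF ij])
  then show "chi n (psi n Z) v = Z v"
    using R_Gr[OF assms ij] descend_preim[OF ij] ij by (simp add: v chi_def Gr_def)
qed

lemma psi_chi:
  assumes U: "U \<in> points (BS n)"
  shows "psi n (chi n U) = U"
proof (rule extensionalityI[of _ "{0..N_of n} \<times> {1..2 * n - 1}"])
  show "psi n (chi n U) \<in> extensional ({0..N_of n} \<times> {1..2 * n - 1})"
    "U \<in> extensional ({0..N_of n} \<times> {1..2 * n - 1})"
    using assms by (simp_all add: psi_def points_BS_iff)
  fix v assume "v \<in> {0..N_of n} \<times> {1..2 * n - 1}"
  then obtain k m where v: "v = (k, m)" and km: "k \<le> N_of n" "m \<in> {1..2 * n - 1}"
    by (cases v) auto
  obtain i j where c: "cell n k m = (i, j)"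
    by fastforce
  show "psi n (chi n U) v = U v"
  proof (cases "boundary n i j")
    case True
    then show ?thesis
      using psi_boundary[OF km c True] BS_at_cell[OF U km c] cell_bounds(1)[OF km c]
      by (simp add: v at_cell_def)
  next
    case False
    then have ij: "(i, j) \<in> R_indices n"
      using cell_boundary_or_index[OF km c] by blast
    then show ?thesis
      using psi_at[OF km c] BS_at_cell[OF U km c] preim_chi[OF U ij] by (simp add: v Zext_index)
  qed
qed

section \<open>Regularity of the two bijections\<close>

lemma finite_factors: "finite (factors (R n))" "finite (factors (BS n))"
proof -
  have "R_indices n \<subseteq> {1..n} \<times> {1..n}"
    by (auto simp: R_indices_def)
  then show "finite (factors (R n))"
    by (simp add: R_def finite_subset)
qed (simp add: BS_def)

lemma plucker_vars_R:
  "((i, j), r) \<in> plucker_vars (R n) \<longleftrightarrow> (i, j) \<in> R_indices n \<and> length r = i \<and> set r \<subseteq> {1..n + 1}"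
  by (simp add: plucker_vars_def R_def)

lemma plucker_vars_BS:
  "((k, m), r) \<in> plucker_vars (BS n) \<longleftrightarrow>
    k \<le> N_of n \<and> m \<in> {1..2 * n - 1} \<and> length r = m \<and> set r \<subseteq> {1..2 * n}"
  by (auto simp: plucker_vars_def BS_def)

text \<open>On a boundary cell the Pluecker coordinates of the standard flag are constants. On other cells
  they are linear forms in the Pluecker coordinates of \<open>Z\<^bsub>i,j\<^esub>\<close>, by Laplace
  expansion of the frame \<open>e\<^sub>1, \<dots>, e\<^bsub>j-1\<^esub>\<close>, lifts.\<close>

lemma morphism_psi: "morphism (R n) (BS n) (psi n)"
proof -
  define expands where "expands i j w \<longleftrightarrow> (\<forall>r b. length r = j - 1 + i \<longrightarrow> set r \<subseteq> {1..2 * n} \<longrightarrow>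
      length b = i \<longrightarrow> plucker (map unit [1..<j] @ b) r
        = (\<Sum>t | length t = i \<and> set t \<subseteq> {1..2 * n}. w r t * plucker b t))" for i j w
  have "\<exists>w. expands i j w" for i j
    using plucker_append_linear[of "{1..2 * n}" "map unit [1..<j]" i] by (simp add: expands_def)
  then obtain w where w: "\<And>i j. expands i j (w i j)"
    by metis
  define E where "E = (\<lambda>(k, m). case cell n k m of (i, j) \<Rightarrow>
      if boundary n i j then (\<lambda>_. 0) else (\<lambda>_. 0 :: nat)((i, j) := 1))"
  define L :: "(nat \<times> nat) \<times> nat list \<Rightarrow> ((nat \<times> nat) \<times> nat list \<Rightarrow> complex) \<Rightarrow> complex"
    where "L = (\<lambda>((k, m), r) p. case cell n k m of (i, j) \<Rightarrow>
      if boundary n i j then plucker (map unit [1..<Suc m]) r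
      else \<Sum>t | length t = i \<and> set t \<subseteq> {1..2 * n}.
        (if set t \<subseteq> {j..n + i} then w i j r t else 0) * p ((i, j), map (down n) t))"
  show ?thesis
  proof (rule morphismI[where E = E and L = L])
    show "finite (factors (R n))" "finite (factors (BS n))"
      by (fact finite_factors)+
    show "psi n Z \<in> points (BS n)" if "Z \<in> points (R n)" for Z
      using that by (rule psi_in_BS)
    show "\<exists>b. frame (Z v) b" if Z: "Z \<in> points (R n)" and v: "v \<in> factors (R n)" for Z v
    proof -
      have "(fst v, snd v) \<in> R_indices n"
        using v by (simp add: R_def)
      then show ?thesis
        using R_frames[OF Z] by (metis prod.collapse)
    qed
  next
    fix v r assume vr: "(v, r) \<in> plucker_vars (BS n)"
    then obtain k m where v: "v = (k, m)" and km: "k \<le> N_of n" "m \<in> {1..2 * n - 1}"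
      by (cases v) (auto simp: plucker_vars_BS)
    obtain i j where c: "cell n k m = (i, j)"
      by fastforce
    show "multihom (plucker_vars (R n)) (E v) (L (v, r))"
    proof (cases "boundary n i j")
      case True
      then show ?thesis
        by (simp add: E_def L_def v c multihom.const del: upt_Suc)
    next
      case False
      then have ij: "(i, j) \<in> R_indices n"
        using cell_boundary_or_index[OF km c] by blast
      have "multihom (plucker_vars (R n)) ((\<lambda>_. 0)((i, j) := 1))
          (\<lambda>p. \<Sum>t | length t = i \<and> set t \<subseteq> {1..2 * n}.
            (if set t \<subseteq> {j..n + i} then w i j r t else 0) * p ((i, j), map (down n) t))"
      proof (rule multihom_linear)
        show "finite {t. length t = i \<and> set t \<subseteq> {1..2 * n}}"
          using finite_lists_length_eq[of "{1..2 * n}" i] by (simp add: conj_commute)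
        \<comment> \<open>Some variable of the right degree, whatever the linear form is.\<close>
        show "((i, j), replicate i 1) \<in> plucker_vars (R n)"
          using ij by (auto simp: plucker_vars_R)
        fix t assume t: "t \<in> {t. length t = i \<and> set t \<subseteq> {1..2 * n}}"
          "(if set t \<subseteq> {j..n + i} then w i j r t else 0) \<noteq> 0"
        then have "set t \<subseteq> {j..n + i}"
          by (auto split: if_splits)
        then have "set (map (down n) t) \<subseteq> Vsub_indices n i j"
          using down_in_Vsub_indices[OF ij] by auto
        also have "\<dots> \<subseteq> {1..n + 1}"
          using ij by (auto simp: Vsub_indices_def R_indices_def)
        finally show "((i, j), map (down n) t) \<in> plucker_vars (R n)"
          using ij t(1) by (simp add: plucker_vars_R)
      qed
      then show ?thesis
        using False by (simp add: E_def L_def v c)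
    qed
  next
    fix Z b v
    assume Z: "Z \<in> points (R n)" and b: "\<And>u. u \<in> factors (R n) \<Longrightarrow> frame (Z u) (b u)"
      and "v \<in> factors (BS n)"
    then obtain k m where v: "v = (k, m)" and km: "k \<le> N_of n" "m \<in> {1..2 * n - 1}"
      by (cases v) (auto simp: BS_def)
    obtain i j where c: "cell n k m = (i, j)"
      by fastforce
    note bounds = cell_bounds[OF km c]
    have fr: "frame (Z u) (b u)" if "u \<in> R_indices n" for u
      using b that by (simp add: R_def)
    let ?b = "if boundary n i j then map unit [1..<Suc m]
      else map unit [1..<j] @ map (lift n i j) (b (i, j))"
    have "plucker ?b r = L (v, r) (\<lambda>(i, r). plucker (b i) r)" if r: "(v, r) \<in> plucker_vars (BS n)" for r
    proof (cases "boundary n i j")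
      case True
      then show ?thesis
        by (simp add: L_def v c del: upt_Suc)
    next
      case False
      then have ij: "(i, j) \<in> R_indices n"
        using cell_boundary_or_index[OF km c] by blast
      have len: "length (b (i, j)) = i"
        using frame_length[OF fr[OF ij]] R_Gr[OF Z ij] by (simp add: Gr_def)
      have "plucker ?b r = (\<Sum>t | length t = i \<and> set t \<subseteq> {1..2 * n}.
          w i j r t * plucker (map (lift n i j) (b (i, j))) t)"
        using False w[of i j] r bounds len by (simp add: v plucker_vars_BS expands_def)
      also have "\<dots> = (\<Sum>t | length t = i \<and> set t \<subseteq> {1..2 * n}.
          (if set t \<subseteq> {j..n + i} then w i j r t else 0) * plucker (b (i, j)) (map (down n) t))"
        by (intro sum.cong) (auto simp: plucker_lift len)
      finally show ?thesis
        using False by (simp add: L_def v c)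
    qed
    moreover have "frame (psi n Z v) ?b"
      unfolding v using psi_frame[OF Z fr km c] .
    ultimately show "\<exists>b'. frame (psi n Z v) b' \<and> (\<forall>r. (v, r) \<in> plucker_vars (BS n) \<longrightarrow>
        plucker b' r = L (v, r) (\<lambda>(i, r). plucker (b i) r))"
      by blast
  qed
qed

text \<open>Each Pluecker coordinate of \<open>Z\<^bsub>i,j\<^esub>\<close> is either zero, when a row outside
  of \<open>V\<^bsub>i,j\<^esub>\<close> occurs, or the coordinate of \<open>U\<^bsub>i,j\<^esub>\<close> with
  the rows \<open>1, \<dots>, j - 1\<close> added in front. An arbitrary frame of
  \<open>U\<^bsub>i,j\<^esub>\<close> need not be of the form \<open>e\<^sub>1, \<dots>,
  e\<^bsub>j-1\<^esub>\<close>, lifts, but its coordinates differ from those of such a frame by a factor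
  \<open>\<delta>\<close>, which is absorbed by rescaling the frame of
  \<open>Z\<^bsub>i,j\<^esub>\<close>.\<close>

lemma morphism_chi: "morphism (BS n) (R n) (chi n)"
proof -
  define pos where "pos = (\<lambda>(i, j). (time n i j, i + j - 1))"
  define L :: "(nat \<times> nat) \<times> nat list \<Rightarrow> ((nat \<times> nat) \<times> nat list \<Rightarrow> complex) \<Rightarrow> complex"
    where "L = (\<lambda>((i, j), r) p.
      if set r \<subseteq> Vsub_indices n i j then p (pos (i, j), [1..<j] @ map (up n i) r) else 0)"
  have pos: "pos v \<in> factors (BS n)" if "v \<in> R_indices n" for v
    using that time_beta(1) index_position by (cases v) (auto simp: pos_def BS_def)
  show ?thesis
  proof (rule morphismI[where E = "\<lambda>v. (\<lambda>_. 0)(pos v := 1)" and L = L])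
    show "finite (factors (BS n))" "finite (factors (R n))"
      by (fact finite_factors)+
    show "chi n U \<in> points (R n)" if "U \<in> points (BS n)" for U
      using that by (rule chi_in_R)
    show "\<exists>b. frame (U v) b" if "U \<in> points (BS n)" "v \<in> factors (BS n)" for U v
    proof -
      have "U v \<in> Gr (snd v) (coord_space (2 * n))"
        using that by (cases v) (auto simp: BS_def)
      then have "cvs.subspace (U v)" "U v \<subseteq> coord_space (2 * n)"
        by (simp_all add: Gr_def)
      then show ?thesis
        using obtain_frame by blast
    qed
  next
    fix v r assume vr: "(v, r) \<in> plucker_vars (R n)"
    then obtain i j where v: "v = (i, j)" and ij: "(i, j) \<in> R_indices n" and len: "length r = i"
      by (cases v) (auto simp: plucker_vars_R)
    have ij': "1 \<le> i" "i \<le> j" "j \<le> n"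
      using ij by (auto simp: R_indices_def)
    have var: "(pos (i, j), [1..<j] @ map (up n i) t) \<in> plucker_vars (BS n)"
      if "length t = i" "set t \<subseteq> Vsub_indices n i j" for t
    proof -
      have "up n i ` set t \<subseteq> {j..n + i}"
        using that up_in_range[OF ij] by auto
      then have "set ([1..<j] @ map (up n i) t) \<subseteq> {1..2 * n}"
        using ij' by fastforce
      then show ?thesis
        using that time_beta(1)[OF ij] index_position[OF ij] ij' by (simp add: pos_def plucker_vars_BS)
    qed
    have "multihom (plucker_vars (BS n)) ((\<lambda>_. 0)(pos (i, j) := 1))
        (\<lambda>p. if set r \<subseteq> Vsub_indices n i j then p (pos (i, j), [1..<j] @ map (up n i) r) else 0)"
    proof (cases "set r \<subseteq> Vsub_indices n i j")
      case True
      then show ?thesis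
        using multihom.var[OF var[OF len True]] by simp
    next
      case False
      \<comment> \<open>The index \<open>n + 1\<close> belongs to every \<open>V\<^bsub>i,j\<^esub>\<close>, so this row tuple yields a variable.\<close>
      have "set (replicate i (n + 1)) \<subseteq> Vsub_indices n i j"
        using ij' by (auto simp: Vsub_indices_def)
      then show ?thesis
        using False multihom_zero[OF var[of "replicate i (n + 1)"]] by simp
    qed
    then show "multihom (plucker_vars (BS n)) ((\<lambda>_. 0)(pos v := 1)) (L (v, r))"
      by (simp add: L_def v)
  next
    fix U c v
    assume U: "U \<in> points (BS n)" and c: "\<And>u. u \<in> factors (BS n) \<Longrightarrow> frame (U u) (c u)"
      and "v \<in> factors (R n)"
    then obtain i j where v: "v = (i, j)" and ij: "(i, j) \<in> R_indices n"
      by (cases v) (auto simp: R_def)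
    obtain b\<^sub>0 where b\<^sub>0: "frame (chi n U (i, j)) b\<^sub>0" "length b\<^sub>0 = i"
      using chi_frame[OF U ij] by blast
    have "frame (U (pos (i, j))) (map unit [1..<j] @ map (lift n i j) b\<^sub>0)"
      using frame_preim[OF ij b\<^sub>0(1) chi_subset_Vsub[OF ij]] preim_chi[OF U ij]
      by (simp add: pos_def at_cell_index[OF ij])
    then obtain \<delta> where \<delta>: "\<delta> \<noteq> 0"
      "\<And>r. plucker (c (pos (i, j))) r = \<delta> * plucker (map unit [1..<j] @ map (lift n i j) b\<^sub>0) r"
      using plucker_frame_change c[OF pos[OF ij]] by metis
    have "b\<^sub>0 \<noteq> []"
      using b\<^sub>0(2) ij by (auto simp: R_indices_def)
    then obtain b where b: "frame (chi n U (i, j)) b" "length b = i"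
      "\<And>r. length r = i \<Longrightarrow> plucker b r = \<delta> * plucker b\<^sub>0 r"
      using frame_rescale[OF b\<^sub>0(1) _ \<delta>(1)] b\<^sub>0(2) by metis
    have "plucker b r = L (v, r) (\<lambda>(u, r). plucker (c u) r)" if r: "(v, r) \<in> plucker_vars (R n)" for r
    proof -
      have len: "length r = i"
        using r by (simp add: v plucker_vars_R)
      show ?thesis
      proof (cases "set r \<subseteq> Vsub_indices n i j")
        case True
        then show ?thesis
          using b(3)[OF len] plucker_frame_preim[OF ij _ True, of b\<^sub>0] len b\<^sub>0(2) \<delta>(2)
          by (simp add: L_def v)
      next
        case False
        then obtain t where t: "t \<in> set r" "t \<notin> Vsub_indices n i j"
          by blast
        have "x t = 0" if "x \<in> set b" for x
        proof -
          have "x \<in> Vsub n i j"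
            using that b(1) chi_subset_Vsub[OF ij] cvs.span_base[of x "set b"] by (auto simp: frame_def)
          then show ?thesis
            using t(2) ij by (auto simp: Vsub_eq R_indices_def)
        qed
        then have "plucker b r = 0"
          using t(1) len b(2) by (intro plucker_zero_row[of t]) auto
        then show ?thesis
          using False by (simp add: L_def v)
      qed
    qed
    then show "\<exists>b'. frame (chi n U v) b' \<and> (\<forall>r. (v, r) \<in> plucker_vars (R n) \<longrightarrow>
        plucker b' r = L (v, r) (\<lambda>(i, r). plucker (c i) r))"
      using b(1) v by blast
  qed
qed

section \<open>The commutative square\<close>

lemma pi_map_eq_proj:
  assumes "1 \<le> i" "i \<le> n"
  shows "pi_map n i w = proj n i i w"
proof
  fix t
  have "(\<Sum>k=i..n + 1. cscale (w k) (unit k)) t = (\<Sum>k=i..n + 1. if k = t then w k else 0)"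
    unfolding sum_cvec_apply by (rule sum.cong) (auto simp: cscale_def unit_def)
  also have "\<dots> = (if t \<in> {i..n + 1} then w t else 0)"
    by (rule sum.delta) simp
  finally have low: "(\<Sum>k=i..n + 1. cscale (w k) (unit k)) t = (if t \<in> {i..n + 1} then w t else 0)" .
  have "(\<Sum>k=n + 2..n + i. cscale (w k) (unit (k - n - 1))) t
      = (\<Sum>k=n + 2..n + i. if k = t + n + 1 then w k else 0)"
    unfolding sum_cvec_apply by (rule sum.cong) (auto simp: cscale_def unit_def)
  also have "\<dots> = (if t \<in> {1..<i} then w (t + n + 1) else 0)"
    using assms by (auto simp: sum.delta)
  finally show "pi_map n i w t = proj n i i w t"
    using low assms by (auto simp: pi_map_def proj_def Vsub_indices_def up_def)
qed

lemma p_map_in_Fla: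
  assumes Z: "Z \<in> points (R n)"
  shows "p_map n Z \<in> points (Fla n)"
proof -
  have ii: "(i, i) \<in> R_indices n" if "i \<in> {1..n}" for i
    using that by (simp add: R_indices_def)
  have "Z (i, i) \<in> Gr i (coord_space (n + 1))" if "i \<in> {1..n}" for i
    using R_Gr[OF Z ii[OF that]] Vsub_subset_coord_space[OF ii[OF that]] by (auto simp: Gr_def)
  moreover have "pr i ` Z (i, i) \<subseteq> Z (i + 1, i + 1)" if "1 \<le> i" "i < n" for i
  proof -
    have idx: "(i, i) \<in> R_indices n" "(i, i + 1) \<in> R_indices n" "(i + 1, i + 1) \<in> R_indices n"
      using that by (auto simp: R_indices_def)
    have "pr i ` Zext n Z i i \<subseteq> Zext n Z i (i + 1)"
      by (rule R_column[OF Z idx(1)])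
    moreover have "Zext n Z (i + 1 - 1) (i + 1) \<subseteq> Zext n Z (i + 1) (i + 1)"
      by (rule R_row[OF Z idx(3)])
    ultimately show ?thesis
      by (simp only: add_diff_cancel_right' Zext_index[OF idx(1)] Zext_index[OF idx(2)] Zext_index[OF idx(3)])
  qed
  ultimately show ?thesis
    using Z by (auto simp: Fla_def p_map_def)
qed

text \<open>The last path runs along the main diagonal: the pair at position \<open>2 * i - 1\<close> is
  \<open>(i, i)\<close>, and the projection for this pair is \<open>\<pi>\<^sub>i\<close>.\<close>

lemma rho_psi:
  assumes Z: "Z \<in> points (R n)"
  shows "rho n (psi n Z) = zeta n (p_map n Z)"
proof -
  have "psi n Z (N_of n, 2 * i - 1) = {w \<in> coord_space (n + i). pi_map n i w \<in> p_map n Z i}"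
    if i: "i \<in> {1..n}" for i
  proof -
    have "2 * i - 1 \<in> {1..2 * n - 1}" and ii: "(i, i) \<in> R_indices n"
      using i by (auto simp: R_indices_def)
    then have "psi n Z (N_of n, 2 * i - 1) = preim n i i (Z (i, i))"
      using psi_at[OF le_refl _ cell_final[OF i]] by (simp add: Zext_index[OF ii])
    then show ?thesis
      using i Z by (simp add: preim_def pi_map_eq_proj p_map_def)
  qed
  then show ?thesis
    using p_map_in_Fla[OF Z] psi_in_BS[OF Z] by (simp add: rho_def zeta_def cong: restrict_cong)
qed

theorem theorem4p8:
  fixes n :: nat
  assumes "n \<ge> 1"
  shows "\<exists>\<psi>. isomorphism (R n) (BS n) \<psi> \<and>
           (\<forall>Z\<in>points (R n). rho n (\<psi> Z) = zeta n (p_map n Z))"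
proof (intro exI[of _ "psi n"] conjI ballI)
  show "isomorphism (R n) (BS n) (psi n)"
    unfolding isomorphism_def using morphism_psi morphism_chi chi_psi psi_chi by blast
qed (rule rho_psi)

end
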